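(* Let $n,d\geq 1$, let $P(\lambda)=A_0+A_1\lambda+\dots+A_d\lambda^d$ be a matrix polynomial of degree $d$ with $A_j\in\mathbb{C}^{n\times n}$, and let $\zeta_1,\dots,\zeta_{nd}$ be its eigenvalues, arranged by non-decreasing modulus. Let $\|\cdot\|$ be any norm on $\mathbb{C}^{n\times n}$ satisfying (A1), assume $\det A_0\neq 0$, and let $c=\frac{|\det A_0|}{\|A_0\|^n}$. Let $\alpha_1\leq\dots\leq\alpha_d$ be the tropical roots of $\mathsf{t}p(x)=\max_{0\leq j\leq d}\|A_j\|x^j$, let $\alpha_0=0$, $\alpha_{d+1}=+\infty$, and for $K\in\{1,\dots,nd\}$ let $\bar\alpha_K=\alpha_{\lceil K/n\rceil}$. Let $K\in\{1,\dots,nd\}$ and let $k^-,k^+$ be integers such that $0\leq k^-<\lceil K/n\rceil\leq k^+-1\leq d$. Put $\delta_-:=\alpha_{k^-}/\alpha_{\lceil K/n\rceil}\leq1$ and $\delta_+:=\alpha_{\lceil K/n\rceil}/\alpha_{k^+}\leq1$. Then $$\frac{|\zeta_1\cdots\zeta_K|}{\bar\alpha_1\cdots\bar\alpha_K}\geq c\,(L_{K/n})^n ,$$ where, for $k^-<k\leq k^+-1$, $$L_k:=\max(L_k^+,L_k^-),\quad L_k^+:=\frac{1}{\mathcal{U}(k^+-k-1,\delta_+)},\quad L_k^-:=\frac{1}{\mathcal{U}(k-k^-,\delta_-)} .$$ Moreover, when $\|\cdot\|$ satisfies (A2), the constant $L_k$ (with $k=K/n$) in the inequality can be replaced by the greater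 constant $$L_k^*:=\max(L_k^{+*},L_k^{-*}),\quad L_k^{+*}:=\frac{1}{\sqrt{\mathcal{U}(k^+-k-1,\delta_+^2)}},\quad L_k^{-*}:=\frac{1}{\sqrt{\mathcal{U}(k-k^-,\delta_-^2)}} .$$
   Context: For real $k\geq0$ and $0\leq\delta\leq1$, $$\mathcal{U}(k,\delta):=\mathcal{E}(k)\left(\frac{1+\delta+\sqrt{k^2(1-\delta)^2+4\delta}}{1-\delta}\right),$$ where $\mathcal{E}(k)=\big(\frac{k+1}{k}\big)^k$ for $k>0$ and $\mathcal{E}(0)=1$, with the conventions $1/0=+\infty$ (so $\mathcal{U}(k,1)=+\infty$) and $1/\infty=0$. Ratios with denominator $\alpha_{d+1}=+\infty$ are $0$. (A1): $|\det A|\leq\|A\|^n$ for all $A\in\mathbb{C}^{n\times n}$. (A2): there exist $Q,Q'\in\mathbb{C}^{n\times n}$ with $\det Q=\det Q'=1$ and $\|QAQ'\|_{\mathrm{nF}}\leq\|A\|$ for all $A\in\mathbb{C}^{n\times n}$, where $\|A\|_{\mathrm{nF}}=\big(\frac1n\sum_{i,j=1}^n|A_{ij}|^2\big)^{1/2}$ is the normalized Frobenius norm. Degree $d$ means $A_d\neq0$. The eigenvalues of $P$ are the roots of the polynomial $\det P(\lambda)$ counted with multiplicities; if $\det P$ has degree less than $nd$, the list is completed to $nd$ entries by infinite eigenvalues, whose modulus is $+\infty$. The tropical roots of $\mathsf{t}p$ are the unique numbers $0\leq\alpha_1\leq\dots\leq\alpha_d$ such that $\mathsf{t}p(x)=\|A_d\|\prod_{j=1}^d\max(x,\alpha_j)$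 for all $x\geq0$. They are all positive when $A_0\neq0$. $\lceil x\rceil$ is the least integer $\geq x$. *)

theory Defs
  imports
    "HOL-Analysis.Analysis"
    "HOL-Computational_Algebra.Polynomial"
begin

section \<open>Matrix polynomials and their eigenvalues\<close>

text \<open>
  A matrix polynomial \<open>P(\<lambda>) = A\<^sub>0 + A\<^sub>1 \<lambda> + \<dots> + A\<^sub>d \<lambda>\<^sup>d\<close> is an element of
  \<^typ>\<open>(complex^'n^'n) poly\<close>, with \<open>A\<^sub>j = coeff P j\<close> and \<open>d = degree P\<close>. Only the additive
  structure of \<^typ>\<open>complex^'n^'n\<close> is used here: its type class multiplication is entrywise, so
  \<^const>\<open>poly\<close> is never applied to \<open>P\<close> itself.
\<close>

definition det_poly :: "(complex^'n^'n) poly \<Rightarrow> complex poly" where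
  "det_poly P = det (\<chi> i j. map_poly (\<lambda>A. A $ i $ j) P)"

lemma poly_det_poly:
  fixes P :: "(complex^'n^'n) poly"
  shows "poly (det_poly P) z = det (\<chi> i j. \<Sum>k\<le>degree P. coeff P k $ i $ j * z ^ k)"
proof -
  have entry: "poly (map_poly (\<lambda>A. A $ i $ j) P) z = (\<Sum>k\<le>degree P. coeff P k $ i $ j * z ^ k)"
    for i j :: 'n
  proof -
    let ?q = "map_poly (\<lambda>A. A $ i $ j) P"
    have deg: "degree ?q \<le> degree P"
      by (rule degree_le) (simp add: coeff_map_poly coeff_eq_0)
    have "poly ?q z = (\<Sum>k\<le>degree ?q. coeff ?q k * z ^ k)"
      by (rule poly_altdef)
    also have "\<dots> = (\<Sum>k\<le>degree P. coeff ?q k * z ^ k)"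
      by (rule sum.mono_neutral_left) (use deg in \<open>auto simp: coeff_eq_0\<close>)
    also have "\<dots> = (\<Sum>k\<le>degree P. coeff P k $ i $ j * z ^ k)"
      by (simp add: coeff_map_poly)
    finally show ?thesis .
  qed
  show ?thesis
    by (simp add: det_poly_def det_def poly_sum poly_prod entry)
qed

text \<open>
  Eigenvalues live in \<^typ>\<open>complex option\<close>, where \<^const>\<open>None\<close> is the infinite eigenvalue.
  The multiset below has \<open>n d\<close> elements as soon as \<open>det P\<close> is not the zero polynomial.
\<close>

definition eigenvalues :: "(complex^'n^'n) poly \<Rightarrow> complex option multiset" where
  "eigenvalues P = image_mset Some (proots (det_poly P))
     + replicate_mset (CARD('n) * degree P - degree (det_poly P)) None"

definition modulus :: "complex option \<Rightarrow> ereal" where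
  "modulus w = (case w of Some z \<Rightarrow> ereal (cmod z) | None \<Rightarrow> \<infinity>)"

definition eigenvalues_ordered :: "(complex^'n^'n) poly \<Rightarrow> (nat \<Rightarrow> complex option) \<Rightarrow> bool" where
  "eigenvalues_ordered P \<zeta> \<longleftrightarrow>
     image_mset \<zeta> (mset_set {1..CARD('n) * degree P}) = eigenvalues P \<and>
     mono_on {1..CARD('n) * degree P} (\<lambda>i. modulus (\<zeta> i))"


section \<open>Norms on the space of matrices\<close>

definition matrix_norm :: "(complex^'n^'n \<Rightarrow> real) \<Rightarrow> bool" where
  "matrix_norm N \<longleftrightarrow>
     (\<forall>A. 0 \<le> N A) \<and> (\<forall>A. N A = 0 \<longleftrightarrow> A = 0) \<and>
     (\<forall>z A. N (map_matrix (\<lambda>a. z * a) A) = cmod z * N A) \<and>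
     (\<forall>A B. N (A + B) \<le> N A + N B)"

definition normalized_frobenius :: "complex^'n^'n \<Rightarrow> real" where
  "normalized_frobenius A =
     sqrt (1 / real CARD('n) * (\<Sum>i\<in>UNIV. \<Sum>j\<in>UNIV. (cmod (A $ i $ j))\<^sup>2))"

definition cond_A1 :: "(complex^'n^'n \<Rightarrow> real) \<Rightarrow> bool" where
  "cond_A1 N \<longleftrightarrow> (\<forall>A. cmod (det A) \<le> N A ^ CARD('n))"

definition cond_A2 :: "(complex^'n^'n \<Rightarrow> real) \<Rightarrow> bool" where
  "cond_A2 N \<longleftrightarrow> (\<exists>Q Q'. det Q = 1 \<and> det Q' = 1 \<and>
     (\<forall>A. normalized_frobenius (Q ** A ** Q') \<le> N A))"


section \<open>Tropical roots\<close>

definition trop_poly :: "(complex^'n^'n \<Rightarrow> real) \<Rightarrow> (complex^'n^'n) poly \<Rightarrow> real \<Rightarrow> real" where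
  "trop_poly N P x = Max ((\<lambda>j. N (coeff P j) * x ^ j) ` {0..degree P})"

definition tropical_roots ::
  "(complex^'n^'n \<Rightarrow> real) \<Rightarrow> (complex^'n^'n) poly \<Rightarrow> (nat \<Rightarrow> real) \<Rightarrow> bool" where
  "tropical_roots N P \<alpha> \<longleftrightarrow>
     (\<forall>j\<in>{1..degree P}. 0 \<le> \<alpha> j) \<and> mono_on {1..degree P} \<alpha> \<and>
     (\<forall>x\<ge>0. trop_poly N P x = N (coeff P (degree P)) * (\<Prod>j=1..degree P. max x (\<alpha> j)))"

text \<open>The tropical roots with the conventions \<open>\<alpha>\<^sub>0 = 0\<close> and \<open>\<alpha>\<^bsub>d+1\<^esub> = \<infinity>\<close>.\<close>

definition ext_root :: "nat \<Rightarrow> (nat \<Rightarrow> real) \<Rightarrow> nat \<Rightarrow> ereal" where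
  "ext_root d \<alpha> j = (if j = 0 then 0 else if j = d + 1 then \<infinity> else ereal (\<alpha> j))"

text \<open>The index \<open>\<lceil>K/n\<rceil>\<close>.\<close>

definition block_index :: "nat \<Rightarrow> nat \<Rightarrow> nat" where
  "block_index n K = nat \<lceil>real K / real n\<rceil>"


section \<open>The constants\<close>

definition \<E> :: "real \<Rightarrow> real" where
  "\<E> k = (if k = 0 then 1 else ((k + 1) / k) powr k)"

text \<open>
  The second factor is a quotient in \<^typ>\<open>ereal\<close>, where \<open>x / 0 = \<infinity>\<close> for \<open>x > 0\<close> and \<open>1 / \<infinity> = 0\<close>. So
  \<open>\<U> k 1 = \<infinity>\<close> needs no separate clause.
\<close>

definition \<U> :: "real \<Rightarrow> real \<Rightarrow> ereal" where
  "\<U> k \<delta> = ereal (\<E> k) *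
     (ereal (1 + \<delta> + sqrt (k\<^sup>2 * (1 - \<delta>)\<^sup>2 + 4 * \<delta>)) / ereal (1 - \<delta>))"

lemma \<U>_1: "k \<ge> 0 \<Longrightarrow> \<U> k 1 = \<infinity>"
  by (auto simp: \<U>_def \<E>_def divide_ereal_def zero_ereal_def[symmetric])

text \<open>Only used for nonnegative arguments.\<close>

definition ereal_sqrt :: "ereal \<Rightarrow> ereal" where
  "ereal_sqrt x = (if x = \<infinity> then \<infinity> else ereal (sqrt (real_of_ereal x)))"

definition L_plus :: "nat \<Rightarrow> real \<Rightarrow> real \<Rightarrow> ereal" where
  "L_plus kp \<delta>p k = 1 / \<U> (real kp - k - 1) \<delta>p"

definition L_minus :: "nat \<Rightarrow> real \<Rightarrow> real \<Rightarrow> ereal" where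
  "L_minus km \<delta>m k = 1 / \<U> (k - real km) \<delta>m"

definition L :: "nat \<Rightarrow> nat \<Rightarrow> real \<Rightarrow> real \<Rightarrow> real \<Rightarrow> ereal" where
  "L km kp \<delta>m \<delta>p k = max (L_plus kp \<delta>p k) (L_minus km \<delta>m k)"

definition L_plus_star :: "nat \<Rightarrow> real \<Rightarrow> real \<Rightarrow> ereal" where
  "L_plus_star kp \<delta>p k = 1 / ereal_sqrt (\<U> (real kp - k - 1) (\<delta>p\<^sup>2))"

definition L_minus_star :: "nat \<Rightarrow> real \<Rightarrow> real \<Rightarrow> ereal" where
  "L_minus_star km \<delta>m k = 1 / ereal_sqrt (\<U> (k - real km) (\<delta>m\<^sup>2))"

definition L_star :: "nat \<Rightarrow> nat \<Rightarrow> real \<Rightarrow> real \<Rightarrow> real \<Rightarrow> ereal" where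
  "L_star km kp \<delta>m \<delta>p k = max (L_plus_star kp \<delta>p k) (L_minus_star km \<delta>m k)"

end

theory Submission
  imports Defs "HOL-Computational_Algebra.Fundamental_Theorem_Algebra"
begin

text \<open>
  Everything rests on one estimate. Put \<open>p = det P\<close>, a scalar polynomial with
  \<open>p 0 = det A\<^sub>0 \<noteq> 0\<close>. Jensen's formula says that the geometric mean of \<open>\<bar>p\<bar>\<close> on the circle of
  radius \<open>r\<close> is \<open>\<bar>p 0\<bar> \<Prod> max(1, r/\<bar>z\<bar>)\<close> over the roots \<open>z\<close> of \<open>p\<close>. Hence for any \<open>K\<close> of the roots
  \<open>\<bar>p 0\<bar> r\<^sup>K \<le> M \<bar>z\<^sub>1 \<dots> z\<^sub>K\<bar>\<close>, where \<open>M\<close> is any bound on that mean. The mean is taken here over the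
  \<open>m\<close>-th roots of \<open>r\<^sup>m\<close> with \<open>m \<rightarrow> \<infinity>\<close>, because the product of \<open>\<bar>w - z\<bar>\<close> over these points is
  \<open>\<bar>z\<^sup>m - r\<^sup>m\<bar>\<close>; so no integral occurs (\<open>jensen_bound\<close>).

  Under (A1) the mean is at most \<open>(\<Sum> \<parallel>A\<^sub>j\<parallel> r\<^sup>j)\<^sup>n\<close>. Under (A2), Hadamard's inequality bounds \<open>\<bar>det\<bar>\<close> by a
  power of the normalized Frobenius norm (\<open>det_le_normalized_frobenius\<close>), the inequality of the means
  replaces the geometric mean by a quadratic one, and Parseval's identity evaluates the latter; the result
  is \<open>(\<Sum> \<parallel>A\<^sub>j\<parallel>\<^sup>2 r\<^sup>2\<^sup>j)\<close> to the power \<open>n/2\<close>. Both cases read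
  \<open>\<bar>det A\<^sub>0\<bar>\<^sup>e r\<^sup>K\<^sup>e \<le> (\<Sum> (\<parallel>A\<^sub>j\<parallel> r\<^sup>j)\<^sup>e)\<^sup>n \<bar>\<zeta>\<^sub>1 \<dots> \<zeta>\<^sub>K\<bar>\<^sup>e\<close> with \<open>e = 1\<close> and \<open>e = 2\<close>
  (\<open>eigenvalue_product_bound\<close>), and from here on they are treated together.

  The tropical roots enter through \<open>\<parallel>A\<^sub>j\<parallel> \<alpha>\<^sub>1 \<dots> \<alpha>\<^sub>j \<le> \<parallel>A\<^sub>0\<parallel>\<close>. With \<open>m = \<lceil>K/n\<rceil>\<close> and radius
  \<open>\<alpha>\<^sub>m \<rho>\<close>, the sum becomes a multiple of \<open>\<Sum> g\<^sub>j \<rho>\<^sup>j\<^sup>e\<close>, where the weights \<open>g\<^sub>j\<close> are the \<open>e\<close>-th powers of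
  \<open>\<Prod>\<^bsub>i\<le>j\<^esub> \<alpha>\<^sub>m/\<alpha>\<^sub>i\<close> divided by their largest value, attained at \<open>j = m\<close>
  (\<open>tropical_scaling\<close>). The weights are at most 1, decay like powers of \<open>\<delta>\<^sub>+\<^sup>e\<close> from \<open>k\<^sup>+ - 1\<close> upwards and like
  powers of \<open>\<delta>\<^sub>-\<^sup>e\<close> from \<open>k\<^sup>-\<close> downwards. Each of these two facts bounds the sum by a two-sided geometric
  series, one for radii above \<open>\<alpha>\<^sub>m\<close> and one for radii below. As functions of \<open>s = \<rho>\<^sup>-\<^sup>e\<close> and
  \<open>s = \<rho>\<^sup>e\<close> respectively, the two series have the same form. Minimizing over \<open>s\<close>
  is a quadratic problem, and \<open>\<U>\<close> bounds the minimum (\<open>geom_bound_optimum\<close>).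
\<close>

section \<open>Roots of unity and a discrete Jensen inequality\<close>

lemma prod_diff_nth_roots:
  fixes c z :: complex
  assumes "c \<noteq> 0" "N > 0"
  shows "(\<Prod>w | w ^ N = c. w - z) = (-1) ^ N * (z ^ N - c)"
proof -
  let ?S = "{w. w ^ N = c}"
  have fin: "finite ?S" and card: "card ?S = N"
    using assms by (auto simp: card_nth_roots intro: finite_nth_roots)
  define p q where "p = monom 1 N - [:c:]" and "q = (\<Prod>w\<in>?S. [:- w, 1:])"
  have "degree p \<le> N"
    by (simp add: p_def degree_diff_le degree_monom_le)
  moreover have "degree q = N"
    by (simp add: q_def degree_prod_sum_eq card)
  moreover have "lead_coeff q = 1"
    by (simp add: q_def lead_coeff_prod)
  moreover have "coeff p N = 1"
    using \<open>N > 0\<close> by (simp add: p_def coeff_pCons split: nat.split)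
  ultimately have "p = q"
    using card fin
    by (intro poly_eqI_degree_lead_coeff[where n = N and A = ?S])
       (auto simp: p_def q_def poly_monom poly_prod)
  hence "poly p z = poly q z" by simp
  hence "(\<Prod>w\<in>?S. z - w) = z ^ N - c"
    by (simp add: p_def q_def poly_monom poly_prod)
  moreover have "(\<Prod>w\<in>?S. w - z) = (\<Prod>w\<in>?S. (-1) * (z - w))"
    by simp
  ultimately show ?thesis
    by (simp only: prod.distrib prod_constant card)
qed

text \<open>
  The index set is invariant under multiplication by a primitive \<open>N\<close>-th root of unity \<open>u\<close>, which multiplies
  the sum by \<open>u ^ k * cnj u ^ l \<noteq> 1\<close>.
\<close>

lemma sum_nth_roots_power_cnj:
  fixes c :: complex
  assumes "c \<noteq> 0" "k < N" "l < N" "k \<noteq> l"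
  shows "(\<Sum>w | w ^ N = c. w ^ k * cnj w ^ l) = 0"
proof -
  let ?S = "{w. w ^ N = c}"
  have "N > 0" using assms by simp
  define u where "u = cis (2 * pi / N)"
  have pow: "u ^ j = cis (2 * pi * real j / real N)" for j
    by (simp add: u_def Complex.DeMoivre mult_ac)
  have "u ^ N = 1"
    using \<open>N > 0\<close> by (simp add: pow)
  have "u ^ k \<noteq> u ^ l"
    using inj_on_eq_iff[OF bij_betw_imp_inj_on[OF Complex.bij_betw_roots_unity[OF \<open>N > 0\<close>]], of k l] assms
    unfolding pow by simp
  have [simp]: "u \<noteq> 0" and cu: "cnj u = inverse u"
    by (simp_all add: u_def cis_cnj)
  have ukl: "u ^ k * cnj u ^ l \<noteq> 1"
    using \<open>u ^ k \<noteq> u ^ l\<close> by (simp add: cu field_simps power_inverse)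
  have "bij_betw (\<lambda>w. u * w) ?S ?S"
    by (rule bij_betwI[where g = "\<lambda>w. w / u"]) (auto simp: power_mult_distrib power_divide \<open>u ^ N = 1\<close>)
  hence "(\<Sum>w\<in>?S. w ^ k * cnj w ^ l) = (\<Sum>w\<in>?S. (u * w) ^ k * cnj (u * w) ^ l)"
    by (rule sum.reindex_bij_betw[symmetric])
  also have "\<dots> = u ^ k * cnj u ^ l * (\<Sum>w\<in>?S. w ^ k * cnj w ^ l)"
    by (simp add: sum_distrib_left power_mult_distrib mult_ac)
  finally show ?thesis
    using ukl by (simp only: mult_cancel_right1) simp
qed

lemma norm_nth_root_of_real:
  assumes "w ^ N = complex_of_real r ^ N" "N > 0" "r > 0"
  shows "cmod w = r"
proof (rule power_eq_imp_eq_base)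
  have "cmod (w ^ N) = r ^ N" using assms by (simp add: norm_power)
  thus "cmod w ^ N = r ^ N" by (simp add: norm_power)
qed (use assms in auto)

text \<open>
  On \<open>N\<close> equidistant points of a circle, the monomials of degree less than \<open>N\<close> are orthogonal.
\<close>

lemma discrete_parseval:
  fixes a :: "nat \<Rightarrow> complex" and r :: real
  assumes "r > 0" "d < N"
  shows "(\<Sum>w | w ^ N = of_real r ^ N. (cmod (\<Sum>k\<le>d. a k * w ^ k))\<^sup>2)
           = N * (\<Sum>k\<le>d. (cmod (a k))\<^sup>2 * r ^ (2 * k))"
proof -
  let ?S = "{w::complex. w ^ N = of_real r ^ N}"
  have "N > 0" using assms by simp
  have card: "card ?S = N"
    using assms by (intro card_nth_roots) auto
  have nw: "cmod w = r" if "w \<in> ?S" for w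
    using that assms by (intro norm_nth_root_of_real[of w N]) auto
  have inner: "(\<Sum>w\<in>?S. w ^ k * cnj w ^ l) = (if k = l then of_nat N * of_real (r ^ (2 * k)) else 0)"
    if "k \<le> d" "l \<le> d" for k l
  proof (cases "k = l")
    case True
    have "(\<Sum>w\<in>?S. w ^ k * cnj w ^ l) = (\<Sum>w\<in>?S. of_real (r ^ (2 * k)))"
    proof (rule sum.cong)
      fix w assume "w \<in> ?S"
      have "w ^ k * cnj w ^ l = (w * cnj w) ^ k" by (simp add: True power_mult_distrib)
      also have "\<dots> = of_real (r ^ (2 * k))"
        using nw[OF \<open>w \<in> ?S\<close>] by (simp add: complex_norm_square[symmetric] power_mult)
      finally show "w ^ k * cnj w ^ l = of_real (r ^ (2 * k))" .
    qed simp
    thus ?thesis using True card by simp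
  next
    case False
    thus ?thesis using that assms by (simp add: sum_nth_roots_power_cnj)
  qed
  have "complex_of_real (\<Sum>w\<in>?S. (cmod (\<Sum>k\<le>d. a k * w ^ k))\<^sup>2)
      = (\<Sum>w\<in>?S. \<Sum>k\<le>d. \<Sum>l\<le>d. a k * cnj (a l) * (w ^ k * cnj w ^ l))"
    unfolding of_real_sum complex_norm_square
    by (simp add: sum_product mult_ac)
  also have "\<dots> = (\<Sum>k\<le>d. \<Sum>w\<in>?S. \<Sum>l\<le>d. a k * cnj (a l) * (w ^ k * cnj w ^ l))"
    by (rule sum.swap)
  also have "\<dots> = (\<Sum>k\<le>d. \<Sum>l\<le>d. \<Sum>w\<in>?S. a k * cnj (a l) * (w ^ k * cnj w ^ l))"
    by (intro sum.cong refl sum.swap)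
  also have "\<dots> = (\<Sum>k\<le>d. \<Sum>l\<le>d. a k * cnj (a l) * (\<Sum>w\<in>?S. w ^ k * cnj w ^ l))"
    by (simp only: sum_distrib_left)
  also have "\<dots> = (\<Sum>k\<le>d. \<Sum>l\<le>d. if k = l then a k * cnj (a l) * (of_nat N * of_real (r ^ (2 * k))) else 0)"
    by (intro sum.cong refl) (simp add: inner)
  also have "\<dots> = (\<Sum>k\<le>d. a k * cnj (a k) * (of_nat N * of_real (r ^ (2 * k))))"
    by simp
  also have "\<dots> = complex_of_real (N * (\<Sum>k\<le>d. (cmod (a k))\<^sup>2 * r ^ (2 * k)))"
    by (simp add: sum_distrib_left complex_norm_square[symmetric] mult_ac del: of_real_power)

  finally show ?thesis by (simp only: of_real_eq_iff)
qed

text \<open>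
  The larger of the two powers dominates. This fails for \<open>cmod z = r\<close>, where the numerator may vanish for
  infinitely many \<open>N\<close>; such radii are reached later by continuity.
\<close>

lemma tendsto_norm_diff_power:
  fixes z :: complex
  assumes "r > 0" "cmod z \<noteq> r"
  shows "(\<lambda>N. cmod (z ^ N - of_real r ^ N) / max r (cmod z) ^ N) \<longlonglongrightarrow> 1"
proof (cases "cmod z < r")
  case True
  have "cmod (z ^ N - of_real r ^ N) / max r (cmod z) ^ N = cmod ((z / of_real r) ^ N - 1)" for N
  proof -
    have "cmod ((z / of_real r) ^ N - 1) = cmod ((z ^ N - of_real r ^ N) / of_real r ^ N)"
      using assms by (simp add: power_divide diff_divide_distrib)
    thus ?thesis using True assms by (simp add: norm_divide norm_power)
  qed
  moreover have "(\<lambda>N. cmod ((z / of_real r) ^ N - 1)) \<longlonglongrightarrow> cmod (0 - 1)"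
    using True assms
    by (intro tendsto_intros LIMSEQ_power_zero) (auto simp: norm_divide)
  ultimately show ?thesis by simp
next
  case False
  hence zr: "cmod z > r" using assms by simp
  hence "z \<noteq> 0" using assms by auto
  have "cmod (z ^ N - of_real r ^ N) / max r (cmod z) ^ N = cmod (1 - (of_real r / z) ^ N)" for N
  proof -
    have "cmod (1 - (of_real r / z) ^ N) = cmod ((z ^ N - of_real r ^ N) / z ^ N)"
      using \<open>z \<noteq> 0\<close> by (simp add: power_divide diff_divide_distrib)
    thus ?thesis using zr assms by (simp add: norm_divide norm_power)
  qed
  moreover have "(\<lambda>N. cmod (1 - (of_real r / z) ^ N)) \<longlonglongrightarrow> cmod (1 - 0)"
    using zr assms \<open>z \<noteq> 0\<close>
    by (intro tendsto_intros LIMSEQ_power_zero) (auto simp: norm_divide)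
  ultimately show ?thesis by simp
qed

lemma tendsto_prod_mset:
  fixes f :: "'a \<Rightarrow> nat \<Rightarrow> real"
  assumes "\<And>x. x \<in># X \<Longrightarrow> f x \<longlonglongrightarrow> g x"
  shows "(\<lambda>N. \<Prod>x\<in>#X. f x N) \<longlonglongrightarrow> (\<Prod>x\<in>#X. g x)"
  using assms by (induction X) (auto intro!: tendsto_mult)

lemma poly_complex_altdef_proots:
  "poly p z = lead_coeff p * (\<Prod>x\<in>#proots p. z - x)" for p :: "complex poly"
proof -
  have "poly p z = poly (smult (lead_coeff p) (\<Prod>x\<in>#proots p. [:-x, 1:])) z"
    by (simp only: complex_poly_decompose_multiset)
  also have "\<dots> = lead_coeff p * (\<Prod>x\<in>#proots p. z - x)"
    by (simp add: poly_prod_mset image_mset.compositionality o_def)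
  finally show ?thesis .
qed

text \<open>
  The product over the circle is exchanged with the product over the linear factors of \<open>p\<close>, each of which
  contributes one factor by \<open>prod_diff_nth_roots\<close>.
\<close>

lemma prod_poly_nth_roots:
  fixes p :: "complex poly" and r :: real
  assumes "r > 0" "N > 0"
  shows "(\<Prod>w | w ^ N = of_real r ^ N. cmod (poly p w))
           = cmod (lead_coeff p) ^ N * (\<Prod>x\<in>#proots p. cmod (x ^ N - of_real r ^ N))"
proof -
  let ?S = "{w::complex. w ^ N = of_real r ^ N}"
  have c: "complex_of_real r ^ N \<noteq> 0" using assms by simp
  have fin: "finite ?S" and card: "card ?S = N"
    using assms card_nth_roots[OF c] by (auto intro: finite_nth_roots)
  have *: "(\<Prod>w\<in>?S. \<Prod>x\<in>#X. cmod (w - x)) = (\<Prod>x\<in>#X. cmod (x ^ N - of_real r ^ N))" for X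
  proof (induction X)
    case (add x X)
    have "(\<Prod>w\<in>?S. cmod (w - x)) = cmod (x ^ N - of_real r ^ N)"
      by (simp add: prod_norm prod_diff_nth_roots[OF c \<open>N > 0\<close>] norm_mult norm_power)
    thus ?case using add by (simp add: prod.distrib)
  qed simp
  have "norm (\<Prod>x\<in>#X. w - x) = (\<Prod>x\<in>#X. cmod (w - x))" for w :: complex and X
    by (induction X) (auto simp: norm_mult)
  hence "(\<Prod>w\<in>?S. cmod (poly p w)) = (\<Prod>w\<in>?S. cmod (lead_coeff p) * (\<Prod>x\<in>#proots p. cmod (w - x)))"
    by (simp add: poly_complex_altdef_proots[of p] norm_mult)
  thus ?thesis by (simp add: prod.distrib card *)
qed

text \<open>
  The \<open>N\<close>-th root of the product over the circle tends to the left-hand side. To avoid \<open>N\<close>-th roots, the argument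
  divides by the \<open>N\<close>-th power of the left-hand side \<open>J\<close>: the quotient tends to 1 but stays below
  \<open>(M / J) ^ N\<close>, which would tend to 0 if \<open>M < J\<close>.
\<close>

lemma jensen_bound_off_roots:
  fixes p :: "complex poly"
  assumes "p \<noteq> 0" "r > 0" "M \<ge> 0" and off: "\<And>x. x \<in># proots p \<Longrightarrow> cmod x \<noteq> r"
    and bound: "\<And>N. N > N0 \<Longrightarrow> (\<Prod>w | w ^ N = of_real r ^ N. cmod (poly p w)) \<le> M ^ N"
  shows "cmod (lead_coeff p) * (\<Prod>x\<in>#proots p. max r (cmod x)) \<le> M"
proof (rule ccontr)
  define J where "J = cmod (lead_coeff p) * (\<Prod>x\<in>#proots p. max r (cmod x))"
  assume "\<not> ?thesis"
  hence "M < J" by (simp add: J_def)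
  hence "J > 0" using \<open>M \<ge> 0\<close> by simp
  have pw: "(\<Prod>x\<in>#X. max r (cmod x)) ^ N = (\<Prod>x\<in>#X. max r (cmod x) ^ N)" for X N
    by (induction X) (auto simp: power_mult_distrib)
  have dv: "(\<Prod>x\<in>#X. f x) / (\<Prod>x\<in>#X. g x) = (\<Prod>x\<in>#X. f x / g x)" for X and f g :: "complex \<Rightarrow> real"
    by (induction X) (auto simp: times_divide_times_eq[symmetric] simp del: times_divide_times_eq)
  let ?h = "\<lambda>N. \<Prod>x\<in>#proots p. cmod (x ^ N - of_real r ^ N) / max r (cmod x) ^ N"
  have "?h \<longlonglongrightarrow> (\<Prod>x\<in>#proots p. 1)"
    using off \<open>r > 0\<close> by (intro tendsto_prod_mset tendsto_norm_diff_power)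
  hence lim1: "?h \<longlonglongrightarrow> 1" by simp
  have le: "?h N \<le> (M / J) ^ N" if "N > N0" for N
  proof -
    have "cmod (lead_coeff p) ^ N * (\<Prod>x\<in>#proots p. cmod (x ^ N - of_real r ^ N)) \<le> M ^ N"
      using bound[OF that] \<open>r > 0\<close> that by (simp add: prod_poly_nth_roots)
    hence "cmod (lead_coeff p) ^ N * (\<Prod>x\<in>#proots p. cmod (x ^ N - of_real r ^ N)) / J ^ N \<le> (M / J) ^ N"
      using \<open>J > 0\<close> by (simp add: power_divide divide_right_mono)
    moreover have "cmod (lead_coeff p) ^ N * (\<Prod>x\<in>#proots p. cmod (x ^ N - of_real r ^ N)) / J ^ N = ?h N"
      using \<open>p \<noteq> 0\<close> by (simp add: J_def power_mult_distrib pw dv[symmetric])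
    ultimately show ?thesis by simp
  qed
  have lim0: "(\<lambda>N. (M / J) ^ N) \<longlonglongrightarrow> 0"
    using \<open>M < J\<close> \<open>J > 0\<close> \<open>M \<ge> 0\<close> by (intro LIMSEQ_power_zero) auto
  have "(1::real) \<le> 0"
  proof (rule LIMSEQ_le[OF lim1 lim0])
    show "\<exists>N1. \<forall>N\<ge>N1. ?h N \<le> (M / J) ^ N"
      using le by (intro exI[of _ "Suc N0"]) auto
  qed
  thus False by simp
qed

text \<open>
  Only finitely many radii carry a root, and both sides are continuous in the radius.
\<close>

lemma jensen_bound:
  fixes p :: "complex poly" and M :: "real \<Rightarrow> real"
  assumes "p \<noteq> 0" "r > 0" "continuous_on {0<..} M" "\<And>r. r > 0 \<Longrightarrow> M r \<ge> 0"
    and bound: "\<And>N r. N > N0 \<Longrightarrow> r > 0 \<Longrightarrow> (\<Prod>w | w ^ N = of_real r ^ N. cmod (poly p w)) \<le> M r ^ N"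
  shows "cmod (lead_coeff p) * (\<Prod>x\<in>#proots p. max r (cmod x)) \<le> M r"
proof -
  define J where "J = (\<lambda>r. cmod (lead_coeff p) * (\<Prod>x\<in>#proots p. max r (cmod x)))"
  have cont: "isCont (\<lambda>r. \<Prod>x\<in>#X. max r (cmod x)) r" for X
    by (induction X) (auto intro!: continuous_intros)
  have "isCont J r"
    unfolding J_def by (intro continuous_intros cont)
  hence limJ: "(J \<longlongrightarrow> J r) (at r)" by (simp add: isCont_def)
  have limM: "(M \<longlongrightarrow> M r) (at r)"
    using assms(2,3) continuous_on_eq_continuous_at[of "{0<..}" M] by (simp add: isCont_def)
  have "\<not> r islimpt (cmod ` set_mset (proots p))"
    by (rule islimpt_finite) simp
  hence "\<forall>\<^sub>F s in at r. s \<notin> cmod ` set_mset (proots p)"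
    by (simp only: islimpt_iff_eventually not_not)
  moreover have "\<forall>\<^sub>F s in at r. s > 0"
    using \<open>r > 0\<close> order_tendstoD(1)[OF tendsto_ident_at] by blast
  ultimately have "\<forall>\<^sub>F s in at r. J s \<le> M s"
  proof eventually_elim
    case (elim s)
    thus ?case unfolding J_def
      using assms by (intro jensen_bound_off_roots[where ?N0.0 = N0]) auto
  qed
  hence "J r \<le> M r" using limJ limM by (intro tendsto_le[of "at r"]) auto
  thus ?thesis by (simp add: J_def)
qed

text \<open>
  In Jensen's inequality, each selected root is estimated by \<open>r \<le> max r (cmod x)\<close> and each other root by
  \<open>cmod x \<le> max r (cmod x)\<close>; the latter moduli are then absorbed into \<open>cmod (poly p 0)\<close>.
\<close>

lemma power_size_le_sub_roots:
  fixes p :: "complex poly"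
  assumes J: "cmod (lead_coeff p) * (\<Prod>x\<in>#proots p. max r (cmod x)) \<le> M"
    and "X \<subseteq># proots p" "r > 0"
  shows "cmod (poly p 0) * r ^ size X \<le> M * (\<Prod>x\<in>#X. cmod x)"
proof -
  define Y where "Y = proots p - X"
  have split: "proots p = X + Y" using assms by (simp add: Y_def)
  have nm: "cmod (\<Prod>x\<in>#W. 0 - x) = (\<Prod>x\<in>#W. cmod x)" for W
    by (induction W) (auto simp: norm_mult)
  have X: "r ^ size X \<le> (\<Prod>x\<in>#X. max r (cmod x))"
    using \<open>r > 0\<close> by (induction X) (auto intro!: mult_mono)
  have Y: "0 \<le> (\<Prod>x\<in>#W. cmod x) \<and> (\<Prod>x\<in>#W. cmod x) \<le> (\<Prod>x\<in>#W. max r (cmod x))" for W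
    using \<open>r > 0\<close> by (induction W) (auto intro!: mult_mono)
  have "cmod (poly p 0) = cmod (lead_coeff p) * (\<Prod>x\<in>#proots p. cmod x)"
    by (simp only: poly_complex_altdef_proots[of p 0] norm_mult nm)
  hence "cmod (poly p 0) * r ^ size X
      = cmod (lead_coeff p) * (r ^ size X * (\<Prod>x\<in>#Y. cmod x)) * (\<Prod>x\<in>#X. cmod x)"
    by (simp add: split)
  also have "\<dots> \<le> cmod (lead_coeff p) * ((\<Prod>x\<in>#X. max r (cmod x)) * (\<Prod>x\<in>#Y. max r (cmod x)))
      * (\<Prod>x\<in>#X. cmod x)"
    using X Y \<open>r > 0\<close> by (intro mult_right_mono mult_left_mono mult_mono) (auto intro: order_trans)
  also have "\<dots> \<le> M * (\<Prod>x\<in>#X. cmod x)"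
    using J Y by (intro mult_right_mono) (auto simp: split)
  finally show ?thesis .
qed

section \<open>Hadamard's inequality for the normalized Frobenius norm\<close>

lemma norm_matrix_sq: "(norm A)\<^sup>2 = (\<Sum>i\<in>UNIV. \<Sum>j\<in>UNIV. (cmod (A $ i $ j))\<^sup>2)"
  for A :: "complex^'n^'m"
  by (simp add: norm_vec_def L2_set_def sum_nonneg)

lemma normalized_frobenius_sq:
  "(normalized_frobenius A)\<^sup>2 = (norm A)\<^sup>2 / real CARD('n)" for A :: "complex^'n^'n"
  by (simp add: normalized_frobenius_def norm_matrix_sq sum_nonneg)

lemma norm_matrix_rows: "(norm A)\<^sup>2 = (\<Sum>i\<in>UNIV. (norm (A $ i))\<^sup>2)"
  for A :: "complex^'n^'m"
  by (simp add: norm_vec_def L2_set_def sum_nonneg)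

lemma det_scaleR: "det (t *\<^sub>R A) = of_real t ^ CARD('n) * det A" for A :: "complex^'n^'n"
proof -
  have "(\<Prod>i\<in>UNIV. (t *\<^sub>R A) $ i $ p i) = of_real t ^ CARD('n) * (\<Prod>i\<in>UNIV. A $ i $ p i)" for p
    by (simp add: scaleR_conv_of_real[where 'a = complex] prod.distrib)
  thus ?thesis
    by (simp add: det_def sum_distrib_left mult_ac)
qed

lemma det_cnj_transpose: "det (\<chi> i j. cnj (A $ j $ i)) = cnj (det A)" for A :: "complex^'n^'n"
proof -
  have "det (\<chi> i j. cnj (A $ j $ i)) = det (transpose (\<chi> i j. cnj (A $ i $ j)))"
    by (rule arg_cong[of _ _ det]) (simp add: transpose_def vec_eq_iff)
  also have "\<dots> = det (\<chi> i j. cnj (A $ i $ j))" by simp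
  also have "\<dots> = cnj (det A)" by (simp add: det_def)
  finally show ?thesis .
qed

lemma det_zero_matrix: "det (0 :: complex^'n^'n) = 0"
  by (rule det_zero_row(1)[of undefined]) (simp add: row_def vec_eq_iff)

lemma continuous_on_det: "continuous_on S (det :: complex^'n^'n \<Rightarrow> complex)"
  unfolding det_def by (intro continuous_intros)

lemma norm_det_orthogonal_rows:
  fixes A :: "complex^'n^'n"
  assumes "\<And>i j. i \<noteq> j \<Longrightarrow> (\<Sum>k\<in>UNIV. A $ i $ k * cnj (A $ j $ k)) = 0"
  shows "(cmod (det A))\<^sup>2 = (\<Prod>i\<in>UNIV. (norm (A $ i))\<^sup>2)"
proof -
  let ?H = "\<chi> i j. cnj (A $ j $ i)"
  have ent: "(A ** ?H) $ i $ j = (\<Sum>k\<in>UNIV. A $ i $ k * cnj (A $ j $ k))" for i j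
    by (simp add: matrix_matrix_mult_def)
  have diag: "(A ** ?H) $ i $ i = of_real ((norm (A $ i))\<^sup>2)" for i
    unfolding ent by (simp add: norm_vec_def L2_set_def sum_nonneg complex_norm_square[symmetric])
  have "complex_of_real ((cmod (det A))\<^sup>2) = det A * det ?H"
    by (simp only: det_cnj_transpose complex_norm_square)
  also have "\<dots> = det (A ** ?H)" by (simp add: det_mul)
  also have "\<dots> = (\<Prod>i\<in>UNIV. (A ** ?H) $ i $ i)"
    by (rule det_diagonal) (use assms ent in auto)
  also have "\<dots> = of_real (\<Prod>i\<in>UNIV. (norm (A $ i))\<^sup>2)"
    by (simp add: diag)
  finally show ?thesis by (simp only: of_real_eq_iff)
qed

lemma prod_le_power_mean:
  fixes x :: "'a \<Rightarrow> real"
  assumes "finite S" "S \<noteq> {}" "\<And>i. i \<in> S \<Longrightarrow> x i \<ge> 0"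
  shows "(\<Prod>i\<in>S. x i) \<le> ((\<Sum>i\<in>S. x i) / card S) ^ card S"
proof -
  have card: "card S > 0" using assms by (simp add: card_gt_0_iff)
  have pos: "(\<Prod>i\<in>S. x i) \<ge> 0" using assms by (intro prod_nonneg) auto
  have "(\<Prod>i\<in>S. x i) = ((\<Prod>i\<in>S. x i) powr (1 / card S)) ^ card S"
    using card pos by (cases "(\<Prod>i\<in>S. x i) = 0") (auto simp: powr_power simp del: prod_zero_iff)
  also have "\<dots> \<le> (\<Sum>i\<in>S. x i / card S) ^ card S"
    using assms by (intro power_mono arith_geom_mean) auto
  finally show ?thesis by (simp add: sum_divide_distrib)
qed

text \<open>
  A Gram-Schmidt step: projecting row \<open>i\<close> onto the orthogonal complement of row \<open>j\<close> keeps the determinant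
  and shortens the row unless the two rows were orthogonal already.
\<close>

lemma shrink_row:
  fixes A :: "complex^'n^'n"
  assumes "i \<noteq> j" and nz: "(\<Sum>k\<in>UNIV. A $ i $ k * cnj (A $ j $ k)) \<noteq> 0"
  obtains B :: "complex^'n^'n" where "det B = det A" "norm B < norm A"
proof -
  define s where "s = (\<Sum>k\<in>UNIV. A $ i $ k * cnj (A $ j $ k))"
  define m where "m = (norm (A $ j))\<^sup>2"
  have m_eq: "complex_of_real m = (\<Sum>k\<in>UNIV. A $ j $ k * cnj (A $ j $ k))"
    by (simp add: m_def norm_vec_def L2_set_def sum_nonneg complex_norm_square[symmetric])
  have "A $ j \<noteq> 0" using nz by auto
  hence "m > 0" by (simp add: m_def)
  \<comment> \<open>adding \<open>t\<close> times row \<open>j\<close> to row \<open>i\<close> makes the rows orthogonal\<close>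
  define t where "t = - s / of_real m"
  define B where "B = (\<chi> k. if k = i then row i A + t *s row j A else row k A)"
  have "det B = det A" unfolding B_def by (rule det_row_operation[OF \<open>i \<noteq> j\<close>])
  have rowi: "B $ i $ k = A $ i $ k + t * A $ j $ k" for k
    by (simp add: B_def row_def)
  have rowk: "B $ k = A $ k" if "k \<noteq> i" for k
    using that by (simp add: B_def row_def vec_eq_iff)
  have nr: "complex_of_real ((norm v)\<^sup>2) = (\<Sum>k\<in>UNIV. v $ k * cnj (v $ k))" for v :: "complex^'n"
    by (simp add: norm_vec_def L2_set_def sum_nonneg complex_norm_square[symmetric])
  have cs: "cnj s = (\<Sum>k\<in>UNIV. A $ j $ k * cnj (A $ i $ k))"
    by (simp add: s_def mult.commute)
  have "complex_of_real ((norm (B $ i))\<^sup>2)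
      = (\<Sum>k\<in>UNIV. A $ i $ k * cnj (A $ i $ k) + cnj t * (A $ i $ k * cnj (A $ j $ k))
          + t * (A $ j $ k * cnj (A $ i $ k)) + t * cnj t * (A $ j $ k * cnj (A $ j $ k)))"
    unfolding nr rowi by (intro sum.cong) (auto simp: algebra_simps)
  also have "\<dots> = (\<Sum>k\<in>UNIV. A $ i $ k * cnj (A $ i $ k)) + cnj t * s + t * cnj s + t * cnj t * of_real m"
    by (simp only: sum.distrib sum_distrib_left[symmetric] m_eq cs s_def[symmetric])
  also have "\<dots> = of_real ((norm (A $ i))\<^sup>2) + cnj t * s + t * cnj s + t * cnj t * of_real m"
    by (simp only: nr)
  also have "cnj t * s + t * cnj s + t * cnj t * of_real m = - (s * cnj s) / of_real m"
    using \<open>m > 0\<close> by (simp add: t_def field_simps)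
  hence "of_real ((norm (A $ i))\<^sup>2) + cnj t * s + t * cnj s + t * cnj t * of_real m
      = complex_of_real ((norm (A $ i))\<^sup>2 - (cmod s)\<^sup>2 / m)"
    by (simp add: complex_norm_square add.assoc del: of_real_power)
  finally have "(norm (B $ i))\<^sup>2 = (norm (A $ i))\<^sup>2 - (cmod s)\<^sup>2 / m"
    by (simp only: of_real_eq_iff)
  hence less: "(norm (B $ i))\<^sup>2 < (norm (A $ i))\<^sup>2"
    using nz \<open>m > 0\<close> by (simp add: s_def)
  have "(norm B)\<^sup>2 < (norm A)\<^sup>2"
    unfolding norm_matrix_rows
  proof (rule sum_strict_mono_ex1)
    show "\<forall>k\<in>UNIV. (norm (B $ k))\<^sup>2 \<le> (norm (A $ k))\<^sup>2"
    proof
      fix k show "(norm (B $ k))\<^sup>2 \<le> (norm (A $ k))\<^sup>2"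
        using less rowk[of k] by (metis less_imp_le order_refl)
    qed
  qed (use less in auto)
  hence "norm B < norm A" by (rule power_less_imp_less_base) simp
  with \<open>det B = det A\<close> show thesis by (rule that)
qed

text \<open>
  Hadamard's inequality combined with that of the means. By compactness \<open>\<bar>det\<bar>\<close> attains a maximum on the
  ball of radius \<open>sqrt n\<close>. A maximizer has orthogonal rows, since otherwise \<open>shrink_row\<close> would give a shorter
  matrix with the same determinant and scaling that one up would increase the determinant. For orthogonal
  rows \<open>A A\<^sup>*\<close> is diagonal, so \<open>\<bar>det A\<bar>\<^sup>2\<close> is the product of the squared row lengths, which have mean at
  most 1. The general case follows by homogeneity.
\<close>

lemma det_le_normalized_frobenius:
  fixes A :: "complex^'n^'n"
  shows "cmod (det A) \<le> normalized_frobenius A ^ CARD('n)"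
proof -
  let ?n = "real CARD('n)"
  have n: "?n > 0" by simp
  let ?C = "cball (0 :: complex^'n^'n) (sqrt ?n)"
  have "compact ?C" "?C \<noteq> {}" by auto
  moreover have "continuous_on ?C (\<lambda>A. cmod (det A))"
    by (intro continuous_intros continuous_on_det)
  ultimately obtain M where M: "M \<in> ?C" and max: "\<And>B. B \<in> ?C \<Longrightarrow> cmod (det B) \<le> cmod (det M)"
    using continuous_attains_sup[of ?C] by blast
  have "(norm (mat 1 :: complex^'n^'n))\<^sup>2 = ?n"
    by (simp add: norm_matrix_sq mat_def if_distrib if_distribR cong: if_cong)
  hence "norm (mat 1 :: complex^'n^'n) = sqrt ?n"
    by (metis norm_ge_zero real_sqrt_unique)
  hence "cmod (det M) \<ge> 1"
    using max[of "mat 1"] by simp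
  \<comment> \<open>the identity matrix lies on the sphere, so the maximum is at least 1 and a shorter competitor is nonzero\<close>
  have orth: "(\<Sum>k\<in>UNIV. M $ i $ k * cnj (M $ j $ k)) = 0" if ij: "i \<noteq> j" for i j
  proof (rule ccontr)
    assume "\<not> ?thesis"
    then obtain B :: "complex^'n^'n" where B: "det B = det M" "norm B < norm M"
      using shrink_row[OF ij] by blast
    have "det B \<noteq> 0" using B \<open>cmod (det M) \<ge> 1\<close> by auto
    hence "B \<noteq> 0" by (auto simp: det_zero_matrix)
    hence "norm B > 0" by simp
    define t where "t = sqrt ?n / norm B"
    have "norm B < sqrt ?n" using B M by simp
    hence "t > 1" using \<open>norm B > 0\<close> by (simp add: t_def)
    have "t *\<^sub>R B \<in> ?C" using \<open>norm B > 0\<close> by (simp add: t_def)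
    hence "cmod (det (t *\<^sub>R B)) \<le> cmod (det M)" by (rule max)
    hence "t ^ CARD('n) * cmod (det M) \<le> cmod (det M)"
      using \<open>t > 1\<close> B by (simp add: det_scaleR norm_mult norm_power)
    moreover have "t ^ CARD('n) > 1" using \<open>t > 1\<close> by (intro one_less_power) auto
    hence "1 * cmod (det M) < t ^ CARD('n) * cmod (det M)"
      using \<open>cmod (det M) \<ge> 1\<close> by (intro mult_strict_right_mono) auto
    ultimately show False by simp
  qed
  have "(cmod (det M))\<^sup>2 = (\<Prod>i\<in>UNIV. (norm (M $ i))\<^sup>2)"
    by (rule norm_det_orthogonal_rows) (rule orth)
  also have "\<dots> \<le> ((\<Sum>i\<in>UNIV. (norm (M $ i))\<^sup>2) / ?n) ^ CARD('n)"
    by (rule prod_le_power_mean) auto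
  also have "\<dots> = ((norm M)\<^sup>2 / ?n) ^ CARD('n)"
    by (simp only: norm_matrix_rows)
  also have "\<dots> \<le> 1 ^ CARD('n)"
  proof (rule power_mono)
    have "(norm M)\<^sup>2 \<le> (sqrt ?n)\<^sup>2" using M by (intro power_mono) auto
    thus "(norm M)\<^sup>2 / ?n \<le> 1" using n by (simp add: field_simps)
  qed simp
  finally have "cmod (det M) \<le> 1"
    by (simp add: power2_le_imp_le abs_square_le_1)
  show ?thesis
  proof (cases "A = 0")
    case True
    thus ?thesis by (simp add: normalized_frobenius_def det_zero_matrix)
  next
    case False
    define f where "f = normalized_frobenius A"
    have f: "f = norm A / sqrt ?n"
      by (simp add: f_def normalized_frobenius_def norm_matrix_sq[symmetric] real_sqrt_divide real_sqrt_mult)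
    hence "f > 0" using False by simp
    have "norm ((1 / f) *\<^sub>R A) = sqrt ?n" using \<open>f > 0\<close> False by (simp add: f)
    hence "cmod (det ((1 / f) *\<^sub>R A)) \<le> 1"
      using max[of "(1 / f) *\<^sub>R A"] \<open>cmod (det M) \<le> 1\<close> by simp
    hence "cmod (det A) / f ^ CARD('n) \<le> 1"
      using \<open>f > 0\<close> by (simp add: det_scaleR norm_mult norm_power power_divide norm_divide)
    thus ?thesis using \<open>f > 0\<close> by (simp add: f_def field_simps)
  qed
qed

section \<open>Determinants of matrix polynomials on circles\<close>

lemma matrix_norm_sum:
  assumes "matrix_norm N" "finite S"
  shows "N (\<Sum>k\<in>S. A k) \<le> (\<Sum>k\<in>S. N (A k))"
  using assms(2)
proof (induction S rule: finite_induct)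
  case empty
  have "N 0 = 0" using assms(1) unfolding matrix_norm_def by blast
  thus ?case by simp
next
  case (insert k S)
  have "N (A k + (\<Sum>k\<in>S. A k)) \<le> N (A k) + N (\<Sum>k\<in>S. A k)"
    using assms(1) by (simp add: matrix_norm_def)
  thus ?case using insert by simp
qed

lemma norm_poly_det_poly_le:
  fixes P :: "(complex^'n^'n) poly"
  assumes "matrix_norm N" "cond_A1 N"
  shows "cmod (poly (det_poly P) w) \<le> (\<Sum>k\<le>degree P. N (coeff P k) * cmod w ^ k) ^ CARD('n)"
proof -
  let ?A = "\<chi> i j. \<Sum>k\<le>degree P. coeff P k $ i $ j * w ^ k"
  have scale: "N (map_matrix (\<lambda>a. z * a) A) = cmod z * N A" for z A
    using assms(1) unfolding matrix_norm_def by blast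
  have eq: "?A = (\<Sum>k\<le>degree P. map_matrix (\<lambda>a. w ^ k * a) (coeff P k))"
    by (simp add: vec_eq_iff mult.commute)
  have "N ?A \<le> (\<Sum>k\<le>degree P. N (map_matrix (\<lambda>a. w ^ k * a) (coeff P k)))"
    unfolding eq by (rule matrix_norm_sum[OF assms(1)]) simp
  also have "\<dots> = (\<Sum>k\<le>degree P. N (coeff P k) * cmod w ^ k)"
    by (intro sum.cong) (simp_all add: scale norm_power mult.commute[of "N _"])
  finally have le: "N ?A \<le> \<dots>" .
  have "cmod (poly (det_poly P) w) = cmod (det ?A)"
    by (simp add: poly_det_poly)
  also have "\<dots> \<le> N ?A ^ CARD('n)"
    using assms(2) unfolding cond_A1_def by blast
  also have "\<dots> \<le> (\<Sum>k\<le>degree P. N (coeff P k) * cmod w ^ k) ^ CARD('n)"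
    using le assms(1) by (intro power_mono) (auto simp: matrix_norm_def)
  finally show ?thesis .
qed

lemma prod_norm_det_poly_le:
  fixes P :: "(complex^'n^'n) poly"
  assumes "matrix_norm N" "cond_A1 N" "r > 0" "m > degree P"
  shows "(\<Prod>w | w ^ m = of_real r ^ m. cmod (poly (det_poly P) w))
           \<le> ((\<Sum>k\<le>degree P. N (coeff P k) * r ^ k) ^ CARD('n)) ^ m"
proof -
  let ?S = "{w::complex. w ^ m = of_real r ^ m}"
  have "(\<Prod>w\<in>?S. cmod (poly (det_poly P) w))
      \<le> (\<Prod>w\<in>?S. (\<Sum>k\<le>degree P. N (coeff P k) * r ^ k) ^ CARD('n))"
  proof (rule prod_mono, intro conjI)
    fix w assume "w \<in> ?S"
    hence "cmod w = r" using assms by (intro norm_nth_root_of_real[of w m]) auto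
    thus "cmod (poly (det_poly P) w) \<le> (\<Sum>k\<le>degree P. N (coeff P k) * r ^ k) ^ CARD('n)"
      using norm_poly_det_poly_le[OF assms(1,2), of P w] by simp
  qed simp
  also have "card ?S = m" using assms by (intro card_nth_roots) auto
  hence "(\<Prod>w\<in>?S. (\<Sum>k\<le>degree P. N (coeff P k) * r ^ k) ^ CARD('n))
      = ((\<Sum>k\<le>degree P. N (coeff P k) * r ^ k) ^ CARD('n)) ^ m" by simp
  finally show ?thesis .
qed

text \<open>
  The factors \<open>Q\<close> and \<open>Q'\<close> do not change the determinant of \<open>P(w)\<close>, so \<open>\<bar>det P(w)\<bar>\<^sup>2\<close> is at most the
  \<open>n\<close>-th power of \<open>\<parallel>Q P(w) Q'\<parallel>\<^sup>2\<close> in the normalized Frobenius norm. The geometric mean over \<open>w\<close> of that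
  squared norm is at most its arithmetic mean, which Parseval's identity evaluates entry by entry.
\<close>

lemma prod_norm_det_poly_le_sq:
  fixes P :: "(complex^'n^'n) poly"
  assumes "matrix_norm N" "cond_A2 N" "r > 0" "m > degree P"
  shows "(\<Prod>w | w ^ m = of_real r ^ m. cmod (poly (det_poly P) w))
           \<le> (sqrt ((\<Sum>k\<le>degree P. (N (coeff P k) * r ^ k)\<^sup>2) ^ CARD('n))) ^ m"
proof -
  let ?S = "{w::complex. w ^ m = of_real r ^ m}" and ?n = "CARD('n)" and ?d = "degree P"
  obtain Q Q' :: "complex^'n^'n" where Q: "det Q = 1" "det Q' = 1"
    and QN: "\<And>A. normalized_frobenius (Q ** A ** Q') \<le> N A"
    using assms(2) unfolding cond_A2_def by blast
  define R where "R k = Q ** coeff P k ** Q'" for k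
  define B where "B w = (\<chi> i j. \<Sum>k\<le>?d. R k $ i $ j * w ^ k)" for w
  have "card ?S = m" using assms by (intro card_nth_roots) auto
  hence card: "card ?S = m" "?S \<noteq> {}" using assms by auto
  have fin: "finite ?S" using assms by (intro finite_nth_roots) auto
  have B: "B w = Q ** (\<chi> i j. \<Sum>k\<le>?d. coeff P k $ i $ j * w ^ k) ** Q'" for w
  proof -
    have "(Q ** (\<chi> i j. \<Sum>k\<le>?d. coeff P k $ i $ j * w ^ k) ** Q') $ i $ j
        = (\<Sum>a\<in>UNIV. \<Sum>b\<in>UNIV. \<Sum>k\<le>?d. Q $ i $ b * coeff P k $ b $ a * Q' $ a $ j * w ^ k)" for i j
      by (simp add: matrix_matrix_mult_def sum_distrib_left sum_distrib_right mult_ac)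
    also have "\<dots> i j = (\<Sum>a\<in>UNIV. \<Sum>k\<le>?d. \<Sum>b\<in>UNIV. Q $ i $ b * coeff P k $ b $ a * Q' $ a $ j * w ^ k)" for i j
      by (intro sum.cong refl sum.swap)
    also have "\<dots> i j = (\<Sum>k\<le>?d. \<Sum>a\<in>UNIV. \<Sum>b\<in>UNIV. Q $ i $ b * coeff P k $ b $ a * Q' $ a $ j * w ^ k)" for i j
      by (rule sum.swap)
    also have "\<dots> i j = B w $ i $ j" for i j
      by (simp add: B_def R_def matrix_matrix_mult_def sum_distrib_left sum_distrib_right mult_ac)
    finally show ?thesis by (simp add: vec_eq_iff)
  qed
  have det: "cmod (poly (det_poly P) w) \<le> normalized_frobenius (B w) ^ ?n" for w
    using det_le_normalized_frobenius[of "B w"] Q by (simp add: B det_mul poly_det_poly)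
  have fsq: "(normalized_frobenius A)\<^sup>2 = (\<Sum>i\<in>UNIV. \<Sum>j\<in>UNIV. (cmod (A $ i $ j))\<^sup>2) / real ?n"
    for A :: "complex^'n^'n"
    by (simp add: normalized_frobenius_sq norm_matrix_sq)
  have "(\<Sum>w\<in>?S. (normalized_frobenius (B w))\<^sup>2)
      = (\<Sum>w\<in>?S. \<Sum>i\<in>UNIV. \<Sum>j\<in>UNIV. (cmod (\<Sum>k\<le>?d. R k $ i $ j * w ^ k))\<^sup>2) / real ?n"
    by (simp add: fsq B_def sum_divide_distrib)
  also have "(\<Sum>w\<in>?S. \<Sum>i\<in>UNIV. \<Sum>j\<in>UNIV. (cmod (\<Sum>k\<le>?d. R k $ i $ j * w ^ k))\<^sup>2)
      = (\<Sum>i\<in>UNIV. \<Sum>w\<in>?S. \<Sum>j\<in>UNIV. (cmod (\<Sum>k\<le>?d. R k $ i $ j * w ^ k))\<^sup>2)"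
    by (rule sum.swap)
  also have "\<dots> = (\<Sum>i\<in>UNIV. \<Sum>j\<in>UNIV. \<Sum>w\<in>?S. (cmod (\<Sum>k\<le>?d. R k $ i $ j * w ^ k))\<^sup>2)"
    by (intro sum.cong refl sum.swap)
  also have "\<dots> = (\<Sum>i\<in>UNIV. \<Sum>j\<in>UNIV. m * (\<Sum>k\<le>?d. (cmod (R k $ i $ j))\<^sup>2 * r ^ (2 * k)))"
    using assms(3,4) by (simp only: discrete_parseval)
  also have "\<dots> = (\<Sum>i\<in>UNIV. \<Sum>k\<le>?d. \<Sum>j\<in>UNIV. m * ((cmod (R k $ i $ j))\<^sup>2 * r ^ (2 * k)))"
    unfolding sum_distrib_left by (intro sum.cong refl sum.swap)
  also have "\<dots> = (\<Sum>k\<le>?d. \<Sum>i\<in>UNIV. \<Sum>j\<in>UNIV. m * ((cmod (R k $ i $ j))\<^sup>2 * r ^ (2 * k)))"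
    by (rule sum.swap)
  also have "\<dots> / real ?n = m * (\<Sum>k\<le>?d. (normalized_frobenius (R k))\<^sup>2 * r ^ (2 * k))"
    by (simp add: fsq sum_distrib_left sum_distrib_right sum_divide_distrib mult_ac)
  finally have mean: "(\<Sum>w\<in>?S. (normalized_frobenius (B w))\<^sup>2) / m
      = (\<Sum>k\<le>?d. (normalized_frobenius (R k))\<^sup>2 * r ^ (2 * k))"
    using assms(4) by simp
  have "(\<Prod>w\<in>?S. (cmod (poly (det_poly P) w))\<^sup>2) \<le> (\<Prod>w\<in>?S. ((normalized_frobenius (B w))\<^sup>2) ^ ?n)"
  proof (rule prod_mono, intro conjI)
    fix w
    have "(cmod (poly (det_poly P) w))\<^sup>2 \<le> (normalized_frobenius (B w) ^ ?n)\<^sup>2"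
      by (intro power_mono det) simp
    thus "(cmod (poly (det_poly P) w))\<^sup>2 \<le> ((normalized_frobenius (B w))\<^sup>2) ^ ?n"
      by (simp add: power_mult[symmetric] mult.commute)
  qed simp
  also have "\<dots> = (\<Prod>w\<in>?S. (normalized_frobenius (B w))\<^sup>2) ^ ?n"
    by (simp add: prod_power_distrib)
  also have "\<dots> \<le> (((\<Sum>w\<in>?S. (normalized_frobenius (B w))\<^sup>2) / card ?S) ^ card ?S) ^ ?n"
    by (intro power_mono prod_le_power_mean fin card prod_nonneg) auto
  also have "\<dots> = ((\<Sum>k\<le>?d. (normalized_frobenius (R k))\<^sup>2 * r ^ (2 * k)) ^ m) ^ ?n"
    by (simp only: card mean)
  also have "\<dots> \<le> ((\<Sum>k\<le>?d. (N (coeff P k) * r ^ k)\<^sup>2) ^ m) ^ ?n"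
  proof (intro power_mono sum_mono zero_le_power sum_nonneg)
    fix k
    have "(normalized_frobenius (R k))\<^sup>2 \<le> (N (coeff P k))\<^sup>2"
      unfolding R_def by (intro power_mono QN) (simp add: normalized_frobenius_def sum_nonneg)
    thus "(normalized_frobenius (R k))\<^sup>2 * r ^ (2 * k) \<le> (N (coeff P k) * r ^ k)\<^sup>2"
      using assms(3) by (simp add: power_mult_distrib power_mult[symmetric] mult.commute mult_right_mono)
  qed (use assms(3) in auto)
  finally have "(\<Prod>w\<in>?S. cmod (poly (det_poly P) w))\<^sup>2
      \<le> ((\<Sum>k\<le>?d. (N (coeff P k) * r ^ k)\<^sup>2) ^ m) ^ ?n"
    by (simp add: prod_power_distrib)
  hence "sqrt ((\<Prod>w\<in>?S. cmod (poly (det_poly P) w))\<^sup>2)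
      \<le> sqrt (((\<Sum>k\<le>?d. (N (coeff P k) * r ^ k)\<^sup>2) ^ m) ^ ?n)"
    by (rule real_sqrt_le_mono)
  thus ?thesis
    by (simp add: prod_nonneg real_sqrt_power power_mult[symmetric] mult.commute)
qed

lemma poly_det_poly_0: "poly (det_poly P) 0 = det (coeff P 0)" for P :: "(complex^'n^'n) poly"
proof -
  have "(\<Sum>k\<le>degree P. coeff P k $ i $ j * 0 ^ k) = coeff P 0 $ i $ j" for i j
    by (simp add: power_0_left if_distrib cong: if_cong)
  hence "(\<chi> i j. \<Sum>k\<le>degree P. coeff P k $ i $ j * 0 ^ k) = coeff P 0"
    by (simp add: vec_eq_iff)
  thus ?thesis by (simp add: poly_det_poly)
qed

lemma count_image_Some: "count (image_mset Some X) (Some x) = count X x"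
  by (induction X) auto

text \<open>
  Counted with multiplicity, so that \<open>power_size_le_sub_roots\<close> applies to the first \<open>K\<close> eigenvalues when all are finite.
\<close>

lemma finite_eigenvalues_subset_proots:
  fixes P :: "(complex^'n^'n) poly"
  assumes "eigenvalues_ordered P \<zeta>" "K \<le> CARD('n) * degree P"
    and fin: "\<And>i. i \<in> {1..K} \<Longrightarrow> \<zeta> i \<noteq> None"
  shows "image_mset (\<lambda>i. the (\<zeta> i)) (mset_set {1..K}) \<subseteq># proots (det_poly P)"
proof (rule mset_subset_eqI)
  fix x
  let ?X = "image_mset (\<lambda>i. the (\<zeta> i)) (mset_set {1..K})"
  have "image_mset Some ?X = image_mset (\<lambda>i. Some (the (\<zeta> i))) (mset_set {1..K})"
    by (simp add: image_mset.compositionality o_def)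
  also have "\<dots> = image_mset \<zeta> (mset_set {1..K})"
    using fin by (intro image_mset_cong) (simp add: option.collapse)
  also have "\<dots> \<subseteq># image_mset \<zeta> (mset_set {1..CARD('n) * degree P})"
    using assms(2) by (intro image_mset_subseteq_mono subset_imp_msubset_mset_set) auto
  also have "\<dots> = eigenvalues P" using assms(1) by (simp add: eigenvalues_ordered_def)
  finally have "count (image_mset Some ?X) (Some x) \<le> count (eigenvalues P) (Some x)"
    by (rule mset_subset_eq_count)
  thus "count ?X x \<le> count (proots (det_poly P)) x"
    by (simp add: eigenvalues_def count_image_Some del: image_mset.compositionality)
qed

lemma eigenvalue_not_0:
  fixes P :: "(complex^'n^'n) poly"
  assumes "eigenvalues_ordered P \<zeta>" "i \<in> {1..CARD('n) * degree P}" "det (coeff P 0) \<noteq> 0"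
  shows "\<zeta> i \<noteq> Some 0"
proof
  assume *: "\<zeta> i = Some 0"
  have "\<zeta> i \<in># eigenvalues P"
    using assms(1,2) unfolding eigenvalues_ordered_def by (metis (no_types, lifting) finite_atLeastAtMost finite_set_mset_mset_set image_eqI set_image_mset)
  hence "0 \<in># proots (det_poly P)" by (auto simp: * eigenvalues_def split: if_splits)
  moreover have "det_poly P \<noteq> 0" using poly_det_poly_0[of P] assms(3) by auto
  ultimately have "poly (det_poly P) 0 = 0" by simp
  thus False using assms(3) by (simp add: poly_det_poly_0)
qed

text \<open>
  The exponent \<open>e\<close> merges the two assumptions on the norm: \<open>e = 1\<close> is the estimate from (A1), and \<open>e = 2\<close>
  is the square of the one from (A2).
\<close>

lemma eigenvalue_product_bound:
  fixes P :: "(complex^'n^'n) poly" and e :: nat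
  assumes "eigenvalues_ordered P \<zeta>" "K \<le> CARD('n) * degree P" "det (coeff P 0) \<noteq> 0"
    and fin: "\<And>i. i \<in> {1..K} \<Longrightarrow> \<zeta> i \<noteq> None"
    and N: "matrix_norm N"
    and e: "e = 1 \<and> cond_A1 N \<or> e = 2 \<and> cond_A2 N" and "r > 0"
  shows "cmod (det (coeff P 0)) ^ e * (r ^ K) ^ e
           \<le> (\<Sum>k\<le>degree P. (N (coeff P k) * r ^ k) ^ e) ^ CARD('n) * (\<Prod>i=1..K. cmod (the (\<zeta> i))) ^ e"
proof -
  let ?p = "det_poly P" and ?n = "CARD('n)" and ?d = "degree P"
  let ?X = "image_mset (\<lambda>i. the (\<zeta> i)) (mset_set {1..K})"
  have "?p \<noteq> 0" using poly_det_poly_0[of P] assms(3) by auto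
  have N0: "N A \<ge> 0" for A using N by (simp add: matrix_norm_def)
  have size: "size ?X = K" by simp
  have prod: "(\<Prod>x\<in>#?X. cmod x) = (\<Prod>i=1..K. cmod (the (\<zeta> i)))"
    by (simp add: image_mset.compositionality o_def prod_unfold_prod_mset)
  have key: "cmod (det (coeff P 0)) * r ^ K \<le> M r * (\<Prod>i=1..K. cmod (the (\<zeta> i)))"
    if "continuous_on {0<..} M" "\<And>r. r > 0 \<Longrightarrow> M r \<ge> 0"
      "\<And>m r. m > ?d \<Longrightarrow> r > 0 \<Longrightarrow> (\<Prod>w | w ^ m = of_real r ^ m. cmod (poly ?p w)) \<le> M r ^ m"
    for M
    using power_size_le_sub_roots[OF jensen_bound[OF \<open>?p \<noteq> 0\<close> \<open>r > 0\<close> that]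
        finite_eigenvalues_subset_proots[OF assms(1,2) fin] \<open>r > 0\<close>]
    unfolding size prod poly_det_poly_0 .
  from e show ?thesis
  proof (elim disjE conjE)
    assume "e = 1" "cond_A1 N"
    have "cmod (det (coeff P 0)) * r ^ K
        \<le> (\<Sum>k\<le>?d. N (coeff P k) * r ^ k) ^ ?n * (\<Prod>i=1..K. cmod (the (\<zeta> i)))"
      by (rule key[of "\<lambda>r. (\<Sum>k\<le>?d. N (coeff P k) * r ^ k) ^ ?n"])
         (auto intro!: continuous_intros sum_nonneg zero_le_power mult_nonneg_nonneg N0 prod_norm_det_poly_le[OF N \<open>cond_A1 N\<close>])
    thus ?thesis by (simp add: \<open>e = 1\<close>)
  next
    assume "e = 2" "cond_A2 N"
    have "cmod (det (coeff P 0)) * r ^ K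
        \<le> sqrt ((\<Sum>k\<le>?d. (N (coeff P k) * r ^ k)\<^sup>2) ^ ?n) * (\<Prod>i=1..K. cmod (the (\<zeta> i)))"
      by (rule key[of "\<lambda>r. sqrt ((\<Sum>k\<le>?d. (N (coeff P k) * r ^ k)\<^sup>2) ^ ?n)"])
         (auto intro!: continuous_intros sum_nonneg zero_le_power mult_nonneg_nonneg N0 prod_norm_det_poly_le_sq[OF N \<open>cond_A2 N\<close>])
    hence "(cmod (det (coeff P 0)) * r ^ K)\<^sup>2
        \<le> (sqrt ((\<Sum>k\<le>?d. (N (coeff P k) * r ^ k)\<^sup>2) ^ ?n) * (\<Prod>i=1..K. cmod (the (\<zeta> i))))\<^sup>2"
      using \<open>r > 0\<close> by (intro power_mono) auto
    thus ?thesis by (simp add: \<open>e = 2\<close> power_mult_distrib sum_nonneg)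
  qed
qed

section \<open>Tropical roots\<close>

lemma trop_poly_ge: "j \<le> degree P \<Longrightarrow> N (coeff P j) * x ^ j \<le> trop_poly N P x"
  unfolding trop_poly_def by (rule Max_ge) auto

lemma trop_poly_0:
  assumes "matrix_norm N"
  shows "trop_poly N P 0 = N (coeff P 0)"
proof -
  have nn: "N A \<ge> 0" for A using assms by (simp add: matrix_norm_def)
  have "(MAX j\<in>{0..degree P}. N (coeff P j) * 0 ^ j) = N (coeff P 0)"
    by (rule Max_eqI) (auto simp: power_0_left nn intro!: image_eqI[of _ _ 0])
  thus ?thesis by (simp add: trop_poly_def)
qed

text \<open>
  The product of the roots is \<open>N (coeff P 0) / N (coeff P (degree P))\<close>, by evaluation at 0.
\<close>

lemma tropical_roots_pos:
  assumes "matrix_norm N" "tropical_roots N P \<alpha>" "coeff P 0 \<noteq> 0" "i \<in> {1..degree P}"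
  shows "\<alpha> i > 0"
proof -
  have nn: "\<alpha> j \<ge> 0" if "j \<in> {1..degree P}" for j using assms(2) that by (simp add: tropical_roots_def)
  have "N (coeff P 0) \<noteq> 0"
    using assms(1,3) unfolding matrix_norm_def by blast
  moreover have "N (coeff P 0) = N (coeff P (degree P)) * (\<Prod>j=1..degree P. max 0 (\<alpha> j))"
    using assms(2) unfolding tropical_roots_def trop_poly_0[OF assms(1), symmetric] by simp
  ultimately have "(\<Prod>j=1..degree P. max 0 (\<alpha> j)) \<noteq> 0" by auto
  hence "max 0 (\<alpha> i) \<noteq> 0" using assms(4) by auto
  thus ?thesis by linarith
qed

text \<open>
  Comparing the \<open>j\<close>-th term of the tropical polynomial with its factored form at the point \<open>\<alpha> j\<close> gives
  \<open>\<parallel>A\<^sub>j\<parallel> \<le> \<parallel>A\<^sub>d\<parallel> \<alpha>\<^bsub>j+1\<^esub> \<dots> \<alpha>\<^sub>d\<close>. Evaluation at 0 identifies \<open>\<parallel>A\<^sub>d\<parallel> \<alpha>\<^sub>1 \<dots> \<alpha>\<^sub>d\<close> as \<open>\<parallel>A\<^sub>0\<parallel>\<close>.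
\<close>

lemma norm_coeff_le_tropical:
  assumes N: "matrix_norm N" and trop: "tropical_roots N P \<alpha>" and "coeff P 0 \<noteq> 0" "j \<le> degree P"
  shows "N (coeff P j) * (\<Prod>i=1..j. \<alpha> i) \<le> N (coeff P 0)"
proof (cases "j = 0")
  case False
  let ?d = "degree P"
  have pos: "\<alpha> i > 0" if "i \<in> {1..?d}" for i
    using tropical_roots_pos[OF N trop assms(3) that] .
  have j: "j \<in> {1..?d}" using False assms by auto
  have mono: "\<alpha> i \<le> \<alpha> k" if "i \<le> k" "i \<in> {1..?d}" "k \<in> {1..?d}" for i k
    using trop that by (auto simp: tropical_roots_def mono_on_def)
  have split: "{1..?d} = {1..j} \<union> {j<..?d}" using j by auto
  have "N (coeff P j) * \<alpha> j ^ j \<le> N (coeff P ?d) * (\<Prod>i=1..?d. max (\<alpha> j) (\<alpha> i))"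
    using trop_poly_ge[OF assms(4), of N "\<alpha> j"] trop pos[OF j] by (simp add: tropical_roots_def)
  also have "(\<Prod>i=1..?d. max (\<alpha> j) (\<alpha> i))
      = (\<Prod>i=1..j. max (\<alpha> j) (\<alpha> i)) * (\<Prod>i\<in>{j<..?d}. max (\<alpha> j) (\<alpha> i))"
    unfolding split by (rule prod.union_disjoint) auto
  also have "(\<Prod>i=1..j. max (\<alpha> j) (\<alpha> i)) = (\<Prod>i=1..j. \<alpha> j)"
    using j by (intro prod.cong) (auto simp: max_def intro!: antisym mono)
  also have "(\<Prod>i\<in>{j<..?d}. max (\<alpha> j) (\<alpha> i)) = (\<Prod>i\<in>{j<..?d}. \<alpha> i)"
    using j by (intro prod.cong) (auto simp: max_def intro!: antisym mono)
  finally have "N (coeff P j) * \<alpha> j ^ j \<le> (N (coeff P ?d) * (\<Prod>i\<in>{j<..?d}. \<alpha> i)) * \<alpha> j ^ j"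
    by (simp add: mult_ac)
  hence "N (coeff P j) \<le> N (coeff P ?d) * (\<Prod>i\<in>{j<..?d}. \<alpha> i)"
    using pos[OF j] by simp
  hence "N (coeff P j) * (\<Prod>i=1..j. \<alpha> i) \<le> N (coeff P ?d) * (\<Prod>i\<in>{j<..?d}. \<alpha> i) * (\<Prod>i=1..j. \<alpha> i)"
    using pos j by (intro mult_right_mono prod_nonneg) (auto intro!: less_imp_le)
  also have "\<dots> = N (coeff P ?d) * ((\<Prod>i=1..j. \<alpha> i) * (\<Prod>i\<in>{j<..?d}. \<alpha> i))"
    by simp
  also have "(\<Prod>i=1..j. \<alpha> i) * (\<Prod>i\<in>{j<..?d}. \<alpha> i) = (\<Prod>i=1..?d. \<alpha> i)"
    unfolding split by (rule prod.union_disjoint[symmetric]) auto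
  also have "\<dots> = (\<Prod>i=1..?d. max 0 (\<alpha> i))"
    using pos by (intro prod.cong) (auto simp: max_def intro: less_imp_le)
  also have "N (coeff P ?d) * \<dots> = N (coeff P 0)"
    using trop unfolding tropical_roots_def trop_poly_0[OF N, symmetric] by simp
  finally show ?thesis .
qed simp

lemma block_index_Suc:
  assumes "n > 0"
  shows "block_index n (Suc i) = Suc (i div n)"
proof -
  have "\<lceil>real (Suc i) / real n\<rceil> = int (i div n) + 1"
  proof (rule ceiling_unique)
    have "n * (i div n) < Suc i" "Suc i \<le> n * (i div n + 1)"
      using mult_div_mod_eq[of n i] mod_less_divisor[OF assms, of i]
      by (simp_all only: distrib_left mult_1_right)
    hence "real (n * (i div n)) < real (Suc i)" "real (Suc i) \<le> real (n * (i div n + 1))"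
      by (simp_all only: of_nat_less_iff of_nat_le_iff)
    thus "real_of_int (int (i div n) + 1) - 1 < real (Suc i) / real n"
      "real (Suc i) / real n \<le> real_of_int (int (i div n) + 1)"
      using assms by (simp_all add: field_simps)
  qed
  thus ?thesis by (simp add: block_index_def nat_add_distrib)
qed

lemma block_index_bounds:
  assumes "n > 0" "i \<in> {1..n * d}"
  shows "1 \<le> block_index n i" "block_index n i \<le> d"
proof -
  obtain j where j: "i = Suc j" using assms(2) by (cases i) auto
  hence "j < d * n" using assms(2) by (simp add: mult.commute)
  hence "j div n < d" by (rule less_mult_imp_div_less)
  thus "1 \<le> block_index n i" "block_index n i \<le> d"
    by (simp_all add: j block_index_Suc[OF assms(1)])
qed

lemma block_index_real_bounds:
  assumes "n > 0" "K > 0"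
  shows "real (block_index n K) - 1 < real K / real n" "real K / real n \<le> real (block_index n K)"
proof -
  have "real K / real n > 0" using assms by simp
  hence "real (block_index n K) = of_int \<lceil>real K / real n\<rceil>"
    by (simp add: block_index_def)
  thus "real (block_index n K) - 1 < real K / real n" "real K / real n \<le> real (block_index n K)"
    by linarith+
qed

lemma prod_block_index:
  fixes f :: "nat \<Rightarrow> real"
  assumes "n > 0"
  shows "(\<Prod>i=1..K. f (block_index n i)) = (\<Prod>j=1..K div n. f j) ^ n * f (Suc (K div n)) ^ (K mod n)"
proof (induction K)
  case (Suc K)
  have "(\<Prod>i=1..Suc K. f (block_index n i))
      = (\<Prod>j=1..K div n. f j) ^ n * f (Suc (K div n)) ^ Suc (K mod n)"
    using Suc by (simp add: block_index_Suc[OF assms])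
  also have "\<dots> = (\<Prod>j=1..Suc K div n. f j) ^ n * f (Suc (Suc K div n)) ^ (Suc K mod n)"
  proof (cases "Suc (K mod n) = n")
    case True
    hence "Suc K mod n = 0" "Suc K div n = Suc (K div n)"
      by (simp_all add: mod_Suc div_Suc)
    thus ?thesis using True by (simp add: power_mult_distrib)
  next
    case False
    hence "Suc K mod n = Suc (K mod n)" "Suc K div n = K div n"
      by (simp_all add: mod_Suc div_Suc)
    thus ?thesis by simp
  qed
  finally show ?case .
qed simp

text \<open>
  The product repeats each of \<open>f 1\<close>, \<dots>, \<open>f (m - 1)\<close> exactly \<open>n\<close> times and fills up with \<open>f m\<close> to \<open>K\<close>
  factors; the second factor on the left turns each of them into \<open>f m\<close>.
\<close>

lemma prod_block_index_scaled:
  fixes f :: "nat \<Rightarrow> real"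
  assumes "n > 0" "K > 0" "\<And>j. j \<in> {1..block_index n K} \<Longrightarrow> f j \<noteq> 0"
  defines "m \<equiv> block_index n K"
  shows "(\<Prod>i=1..K. f (block_index n i)) * (\<Prod>j=1..m. f m / f j) ^ n = f m ^ K"
proof -
  obtain K' where K: "K = Suc K'" using \<open>K > 0\<close> by (cases K) auto
  define q where "q = K' div n"
  have m: "m = Suc q" by (simp add: m_def K q_def block_index_Suc[OF assms(1)])
  have nz: "(\<Prod>j=1..q. f j) \<noteq> 0" "f m \<noteq> 0"
    using assms(3) by (auto simp: m m_def[symmetric])
  have "(\<Prod>i=1..K. f (block_index n i)) = (\<Prod>j=1..q. f j) ^ n * f m ^ Suc (K' mod n)"
    using prod_block_index[OF assms(1), of f K']
    by (simp add: K block_index_Suc[OF assms(1)] q_def[symmetric] m)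
  moreover have "(\<Prod>j=1..m. f m / f j) = f m ^ q / (\<Prod>j=1..q. f j)"
    using nz by (simp add: m prod_dividef)
  ultimately have "(\<Prod>i=1..K. f (block_index n i)) * (\<Prod>j=1..m. f m / f j) ^ n
      = f m ^ Suc (K' mod n) * (f m ^ q) ^ n"
    using nz by (simp add: power_divide)
  also have "\<dots> = f m ^ (Suc (K' mod n) + q * n)"
    by (simp only: power_add power_mult)
  also have "Suc (K' mod n) + q * n = K" by (simp add: q_def K)
  finally show ?thesis .
qed

lemma geometric_decay:
  fixes b :: "nat \<Rightarrow> real"
  assumes "p \<le> j" "t \<ge> 0" "\<And>i. p \<le> i \<Longrightarrow> i < j \<Longrightarrow> b (Suc i) \<le> t * b i"
  shows "b j \<le> t ^ (j - p) * b p"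
  using assms(1,3)
proof (induction j rule: dec_induct)
  case (step j)
  have "b (Suc j) \<le> t * b j" using step by simp
  also have "\<dots> \<le> t * (t ^ (j - p) * b p)" using step \<open>t \<ge> 0\<close> by (intro mult_left_mono) auto
  finally show ?case using step by (simp add: Suc_diff_le)
qed simp

lemma geometric_growth:
  fixes b :: "nat \<Rightarrow> real"
  assumes "p \<le> j" "t \<ge> 0" "\<And>i. p \<le> i \<Longrightarrow> i < j \<Longrightarrow> b i \<le> t * b (Suc i)"
  shows "b p \<le> t ^ (j - p) * b j"
  using assms(1,3)
proof (induction j rule: dec_induct)
  case (step j)
  have "b p \<le> t ^ (j - p) * b j" using step by simp
  also have "\<dots> \<le> t ^ (j - p) * (t * b (Suc j))" using step \<open>t \<ge> 0\<close> by (intro mult_left_mono) auto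
  finally show ?case using step by (simp add: Suc_diff_le mult_ac)
qed simp

text \<open>
  As a function of \<open>j\<close> this is, up to the factor \<open>\<parallel>A\<^sub>0\<parallel>\<close>, the tropical bound for \<open>\<parallel>A\<^sub>j\<parallel> x\<^sup>j\<close> at the point
  \<open>x = \<alpha> m\<close>. It is non-decreasing up to \<open>j = m\<close> and non-increasing from there on.
\<close>

definition ratio_prod :: "(nat \<Rightarrow> real) \<Rightarrow> nat \<Rightarrow> nat \<Rightarrow> real" where
  "ratio_prod \<alpha> m j = (\<Prod>i=1..j. \<alpha> m / \<alpha> i)"

lemma ratio_prod_Suc: "ratio_prod \<alpha> m (Suc j) = ratio_prod \<alpha> m j * (\<alpha> m / \<alpha> (Suc j))"
  by (simp add: ratio_prod_def)

lemma ratio_prod_pos: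
  assumes "\<And>i. i \<in> {1..d} \<Longrightarrow> \<alpha> i > 0" "m \<in> {1..d}" "j \<le> d"
  shows "ratio_prod \<alpha> m j > 0"
  unfolding ratio_prod_def
proof (rule prod_pos)
  fix i assume "i \<in> {1..j}"
  thus "\<alpha> m / \<alpha> i > 0" using assms by (intro divide_pos_pos assms(1)) auto
qed

lemma ratio_prod_decay:
  assumes \<alpha>: "\<And>i. i \<in> {1..d} \<Longrightarrow> \<alpha> i > 0" "mono_on {1..d} \<alpha>" and m: "m \<in> {1..d}"
    and "p \<le> j" "j \<le> d" "\<delta> \<ge> 0" "p < d \<Longrightarrow> \<alpha> m / \<alpha> (Suc p) \<le> \<delta>"
  shows "ratio_prod \<alpha> m j \<le> \<delta> ^ (j - p) * ratio_prod \<alpha> m p"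
proof (rule geometric_decay)
  fix i assume i: "p \<le> i" "i < j"
  have "\<alpha> m > 0" "\<alpha> (Suc p) > 0" "\<alpha> (Suc i) > 0" "ratio_prod \<alpha> m i > 0"
    using m i \<open>j \<le> d\<close> by (auto intro!: \<alpha>(1) ratio_prod_pos[of d])
  moreover have "\<alpha> (Suc p) \<le> \<alpha> (Suc i)"
    using \<alpha>(2) i \<open>j \<le> d\<close> by (auto simp: mono_on_def)
  ultimately have "\<alpha> m / \<alpha> (Suc i) \<le> \<alpha> m / \<alpha> (Suc p)"
    by (intro divide_left_mono) auto
  also have "\<dots> \<le> \<delta>" using assms(7) i \<open>j \<le> d\<close> by simp
  finally have "ratio_prod \<alpha> m i * (\<alpha> m / \<alpha> (Suc i)) \<le> ratio_prod \<alpha> m i * \<delta>"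
    using \<open>ratio_prod \<alpha> m i > 0\<close> by (intro mult_left_mono) auto
  thus "ratio_prod \<alpha> m (Suc i) \<le> \<delta> * ratio_prod \<alpha> m i"
    by (simp add: ratio_prod_Suc mult.commute)
qed (use assms in auto)

lemma ratio_prod_growth:
  assumes \<alpha>: "\<And>i. i \<in> {1..d} \<Longrightarrow> \<alpha> i > 0" "mono_on {1..d} \<alpha>" and m: "m \<in> {1..d}"
    and "j \<le> p" "p \<le> d" "\<delta> \<ge> 0" "p > 0 \<Longrightarrow> \<alpha> p / \<alpha> m \<le> \<delta>"
  shows "ratio_prod \<alpha> m j \<le> \<delta> ^ (p - j) * ratio_prod \<alpha> m p"
proof (rule geometric_growth)
  fix i assume i: "j \<le> i" "i < p"
  have pos: "\<alpha> m > 0" "\<alpha> (Suc i) > 0" "ratio_prod \<alpha> m (Suc i) > 0"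
    using m i \<open>p \<le> d\<close> by (auto intro!: \<alpha>(1) ratio_prod_pos[of d])
  have "\<alpha> (Suc i) \<le> \<alpha> p"
    using \<alpha>(2) i \<open>p \<le> d\<close> by (auto simp: mono_on_def)
  hence "\<alpha> (Suc i) / \<alpha> m \<le> \<alpha> p / \<alpha> m"
    using pos by (intro divide_right_mono) auto
  also have "\<dots> \<le> \<delta>" using assms(7) i by simp
  finally have "ratio_prod \<alpha> m (Suc i) * (\<alpha> (Suc i) / \<alpha> m) \<le> ratio_prod \<alpha> m (Suc i) * \<delta>"
    using pos by (intro mult_left_mono) auto
  moreover have "ratio_prod \<alpha> m (Suc i) * (\<alpha> (Suc i) / \<alpha> m) = ratio_prod \<alpha> m i"
    using pos by (simp add: ratio_prod_Suc)
  ultimately show "ratio_prod \<alpha> m i \<le> \<delta> * ratio_prod \<alpha> m (Suc i)"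
    by (simp add: mult.commute)
qed (use assms in auto)

lemma ratio_prod_le:
  assumes \<alpha>: "\<And>i. i \<in> {1..d} \<Longrightarrow> \<alpha> i > 0" "mono_on {1..d} \<alpha>" and m: "m \<in> {1..d}" and "j \<le> d"
  shows "ratio_prod \<alpha> m j \<le> ratio_prod \<alpha> m m"
proof (cases "j \<le> m")
  case True
  thus ?thesis
    using ratio_prod_growth[OF assms(1-3) True, of 1] m \<alpha>(1)[OF m] by simp
next
  case False
  have "\<alpha> m / \<alpha> (Suc m) \<le> 1" if "m < d"
    using \<alpha>(1)[of "Suc m"] \<alpha>(2) m that by (auto simp: mono_on_def)
  thus ?thesis
    using ratio_prod_decay[OF assms(1-3), of m j 1] False \<open>j \<le> d\<close> by simp
qed

section \<open>The optimal radius\<close>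

text \<open>
  The real value of \<open>\<U>\<close>, meaningful for \<open>\<delta> < 1\<close>.
\<close>

definition \<U>\<^sub>r :: "real \<Rightarrow> real \<Rightarrow> real" where
  "\<U>\<^sub>r k \<delta> = \<E> k * ((1 + \<delta> + sqrt (k\<^sup>2 * (1 - \<delta>)\<^sup>2 + 4 * \<delta>)) / (1 - \<delta>))"

lemma \<E>_ge_1: "k \<ge> 0 \<Longrightarrow> \<E> k \<ge> 1"
  by (auto simp: \<E>_def intro!: ge_one_powr_ge_zero)

lemma \<U>\<^sub>r_ge_1:
  assumes "k \<ge> 0" "0 \<le> \<delta>" "\<delta> < 1"
  shows "\<U>\<^sub>r k \<delta> \<ge> 1"
proof -
  have "sqrt (k\<^sup>2 * (1 - \<delta>)\<^sup>2 + 4 * \<delta>) \<ge> 0" using assms by simp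
  hence "(1 + \<delta> + sqrt (k\<^sup>2 * (1 - \<delta>)\<^sup>2 + 4 * \<delta>)) / (1 - \<delta>) \<ge> 1"
    using assms by (simp add: field_simps)
  thus ?thesis unfolding \<U>\<^sub>r_def
    using \<E>_ge_1[OF assms(1)] mult_mono[of 1 "\<E> k" 1] by fastforce
qed

lemma \<U>_eq_\<U>\<^sub>r: "\<delta> < 1 \<Longrightarrow> \<U> k \<delta> = ereal (\<U>\<^sub>r k \<delta>)"
  by (simp add: \<U>_def \<U>\<^sub>r_def)

text \<open>
  This makes the constants for (A2) the better ones. As \<open>1 - \<delta>\<^sup>2 = (1 + \<delta>) (1 - \<delta>)\<close>, cancelling
  \<open>1 + \<delta>\<close> in the quotient at \<open>\<delta>\<^sup>2\<close> shows that \<open>\<U>\<^sub>r\<close> at \<open>\<delta>\<^sup>2\<close> is at most its value at \<open>\<delta>\<close>, which is at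
  least 1.
\<close>

lemma \<U>\<^sub>r_square_le:
  assumes "k \<ge> 0" "0 \<le> \<delta>" "\<delta> < 1"
  shows "\<U>\<^sub>r k (\<delta>\<^sup>2) \<le> (\<U>\<^sub>r k \<delta>)\<^sup>2"
proof -
  define W where "W = (1 + \<delta> + sqrt (k\<^sup>2 * (1 - \<delta>)\<^sup>2 + 4 * \<delta>)) / (1 - \<delta>)"
  have "sqrt (k\<^sup>2 * (1 - \<delta>\<^sup>2)\<^sup>2 + 4 * \<delta>\<^sup>2) \<le> sqrt ((1 + \<delta>)\<^sup>2 * (k\<^sup>2 * (1 - \<delta>)\<^sup>2 + 4 * \<delta>))"
  proof (rule real_sqrt_le_mono)
    have "4 * \<delta>\<^sup>2 \<le> (1 + \<delta>)\<^sup>2 * (4 * \<delta>)"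
    proof -
      have "\<delta>\<^sup>2 \<le> 1 * \<delta>" unfolding power2_eq_square using assms by (intro mult_right_mono) auto
      also have "\<dots> \<le> (1 + \<delta>)\<^sup>2 * \<delta>"
        using assms by (intro mult_right_mono) (auto simp: power2_sum)
      finally show ?thesis by simp
    qed
    moreover have "k\<^sup>2 * (1 - \<delta>\<^sup>2)\<^sup>2 = (1 + \<delta>)\<^sup>2 * (k\<^sup>2 * (1 - \<delta>)\<^sup>2)"
      by (simp add: power2_eq_square algebra_simps)
    ultimately show "k\<^sup>2 * (1 - \<delta>\<^sup>2)\<^sup>2 + 4 * \<delta>\<^sup>2 \<le> (1 + \<delta>)\<^sup>2 * (k\<^sup>2 * (1 - \<delta>)\<^sup>2 + 4 * \<delta>)"
      by (simp only: distrib_left add_left_mono)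
  qed
  also have "\<dots> = (1 + \<delta>) * sqrt (k\<^sup>2 * (1 - \<delta>)\<^sup>2 + 4 * \<delta>)"
    using assms by (simp add: real_sqrt_mult)
  finally have "1 + \<delta>\<^sup>2 + sqrt (k\<^sup>2 * (1 - \<delta>\<^sup>2)\<^sup>2 + 4 * \<delta>\<^sup>2)
      \<le> (1 + \<delta>) * (1 + \<delta> + sqrt (k\<^sup>2 * (1 - \<delta>)\<^sup>2 + 4 * \<delta>))"
    using assms by (simp add: power2_eq_square algebra_simps)
  hence "(1 + \<delta>\<^sup>2 + sqrt (k\<^sup>2 * (1 - \<delta>\<^sup>2)\<^sup>2 + 4 * \<delta>\<^sup>2)) / (1 - \<delta>\<^sup>2)
      \<le> (1 + \<delta>) * (1 + \<delta> + sqrt (k\<^sup>2 * (1 - \<delta>)\<^sup>2 + 4 * \<delta>)) / (1 - \<delta>\<^sup>2)"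
    using assms by (intro divide_right_mono) (auto simp: power_le_one)
  also have "1 - \<delta>\<^sup>2 = (1 + \<delta>) * (1 - \<delta>)" by (simp add: power2_eq_square algebra_simps)
  also have "(1 + \<delta>) * (1 + \<delta> + sqrt (k\<^sup>2 * (1 - \<delta>)\<^sup>2 + 4 * \<delta>)) / ((1 + \<delta>) * (1 - \<delta>)) = W"
    using assms by (simp add: W_def)
  finally have "(1 + \<delta>\<^sup>2 + sqrt (k\<^sup>2 * (1 - \<delta>\<^sup>2)\<^sup>2 + 4 * \<delta>\<^sup>2)) / (1 - \<delta>\<^sup>2) \<le> W"
    by (simp only: \<open>1 - \<delta>\<^sup>2 = (1 + \<delta>) * (1 - \<delta>)\<close>)
  hence "\<U>\<^sub>r k (\<delta>\<^sup>2) \<le> \<U>\<^sub>r k \<delta>"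
    unfolding \<U>\<^sub>r_def W_def using \<E>_ge_1[OF assms(1)] by (intro mult_left_mono) auto
  also have "\<dots> \<le> \<U>\<^sub>r k \<delta> * \<U>\<^sub>r k \<delta>"
    using \<U>\<^sub>r_ge_1[OF assms] by simp
  finally show ?thesis by (simp add: power2_eq_square)
qed

text \<open>
  The second factor is the two-sided series \<open>\<Sum> s\<^sup>i + \<Sum> (\<delta>/s)\<^sup>i\<close> with the common term 1 counted once. It
  converges for \<open>\<delta> < s < 1\<close>.
\<close>

definition geom_bound :: "real \<Rightarrow> real \<Rightarrow> real \<Rightarrow> real" where
  "geom_bound k \<delta> s = s powr (- k) * (1 / (1 - s) + 1 / (1 - \<delta> / s) - 1)"

text \<open>
  The critical points of \<open>geom_bound k \<delta>\<close> between \<open>\<delta>\<close> and 1 satisfy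
  \<open>(k + 1) s\<^sup>2 = k (1 + \<delta>) s + (1 - k) \<delta>\<close>; \<open>s\<close> is the larger
  solution. There the second factor equals that of \<open>\<U>\<close>, and \<open>s \<ge> k / (k + 1)\<close> bounds the first factor
  by \<open>\<E> k\<close>. For \<open>k = \<delta> = 0\<close> the infimum is the limit for \<open>s \<rightarrow> 0\<close> and is not attained.
\<close>

lemma geom_bound_optimum:
  assumes "k \<ge> 0" "0 \<le> \<delta>" "\<delta> < 1" and nd: "k > 0 \<or> \<delta> > 0"
  obtains s where "\<delta> < s" "0 < s" "s < 1" "geom_bound k \<delta> s \<le> \<U>\<^sub>r k \<delta>"
proof
  define D where "D = sqrt (k\<^sup>2 * (1 - \<delta>)\<^sup>2 + 4 * \<delta>)"
  define s where "s = (k * (1 + \<delta>) + D) / (2 * (k + 1))"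
  have D2: "D\<^sup>2 = k\<^sup>2 * (1 - \<delta>)\<^sup>2 + 4 * \<delta>" using assms by (simp add: D_def)
  have "D \<ge> 0" using assms by (simp add: D_def)
  have "(k * (1 - \<delta>))\<^sup>2 \<le> D\<^sup>2" using assms by (simp add: D2 power_mult_distrib)
  hence D_ge: "k * (1 - \<delta>) \<le> D" by (rule power2_le_imp_le) fact
  have sk: "2 * (k + 1) * s = k * (1 + \<delta>) + D" using assms by (simp add: s_def)
  show "s < 1"
  proof -
    have "4 * \<delta> < 4 + 4 * (k * (1 - \<delta>))"
      using assms mult_nonneg_nonneg[of k "1 - \<delta>"] by linarith
    hence "D\<^sup>2 < (2 + k * (1 - \<delta>))\<^sup>2"
      by (simp add: D2 power2_sum power_mult_distrib)
    hence "D < 2 + k * (1 - \<delta>)" using assms by (intro power_less_imp_less_base[of D 2]) auto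
    hence "k * (1 + \<delta>) + D < 2 * (k + 1)" by (simp add: algebra_simps)
    thus ?thesis using assms by (simp add: s_def)
  qed
  have ks: "k / (k + 1) \<le> s"
  proof -
    have "2 * k \<le> k * (1 + \<delta>) + D" using D_ge by (simp add: algebra_simps)
    hence "2 * k / (2 * (k + 1)) \<le> s" unfolding s_def using assms by (intro divide_right_mono) auto
    thus ?thesis by (subst (asm) mult_divide_mult_cancel_left) auto
  qed
  show "\<delta> < s"
  proof (cases "\<delta> = 0")
    case True
    with nd have "k / (k + 1) > 0" by simp
    with True ks show ?thesis by linarith
  next
    case False
    have "(2 * \<delta> - k * (1 - \<delta>))\<^sup>2 < D\<^sup>2"
    proof -
      \<comment> \<open>\<open>\<delta> < s\<close> amounts to \<open>2 \<delta> - k (1 - \<delta>) < D\<close>\<close>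
      have "D\<^sup>2 - (2 * \<delta> - k * (1 - \<delta>))\<^sup>2 = 4 * \<delta> * (1 - \<delta>) * (1 + k)"
        unfolding D2 by (simp add: power2_eq_square algebra_simps)
      also have "\<dots> > 0" using False assms by simp
      finally show ?thesis by simp
    qed
    hence "2 * \<delta> - k * (1 - \<delta>) < D" using \<open>D \<ge> 0\<close> by (rule power_less_imp_less_base)
    hence "2 * (k + 1) * \<delta> < 2 * (k + 1) * s" unfolding sk by (simp add: algebra_simps)
    thus ?thesis using assms by simp
  qed
  thus "0 < s" using assms by linarith
  have quad: "(k + 1) * s\<^sup>2 = k * (1 + \<delta>) * s + (1 - k) * \<delta>"
  proof -
    have "(2 * (k + 1) * s - k * (1 + \<delta>))\<^sup>2 = k\<^sup>2 * (1 - \<delta>)\<^sup>2 + 4 * \<delta>"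
      by (simp only: sk add_diff_cancel_left' D2)
    hence "4 * (k + 1) * ((k + 1) * s\<^sup>2 - k * (1 + \<delta>) * s - (1 - k) * \<delta>) = 0"
      by (simp add: power2_eq_square algebra_simps)
    thus ?thesis using assms by simp
  qed
  have Ds: "D = 2 * (k + 1) * s - k * (1 + \<delta>)" by (simp only: sk add_diff_cancel_left')
  \<comment> \<open>the quadratic equation makes \<open>(1 - s) (s - \<delta>)\<close> linear in \<open>s\<close>, as \<open>D\<close> already is\<close>
  have id: "s * (1 - \<delta>)\<^sup>2 = (1 - s) * (s - \<delta>) * (1 + \<delta> + D)"
  proof -
    have a: "(k + 1) * ((1 - s) * (s - \<delta>)) = (1 + \<delta>) * s - 2 * \<delta>"
      using quad by (simp add: power2_eq_square algebra_simps)
    have "(k + 1) * ((1 - s) * (s - \<delta>) * (1 + \<delta> + D))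
        = ((1 + \<delta>) * s - 2 * \<delta>) * (2 * (k + 1) * s + (1 - k) * (1 + \<delta>))"
      unfolding a[symmetric] Ds by (simp add: algebra_simps)
    also have "\<dots> = 2 * (1 + \<delta>) * ((k + 1) * s\<^sup>2) + (1 - k) * (1 + \<delta>)\<^sup>2 * s
        - 4 * \<delta> * (k + 1) * s - 2 * \<delta> * (1 - k) * (1 + \<delta>)"
      by (simp add: power2_eq_square algebra_simps)
    also have "\<dots> = (k + 1) * (s * (1 - \<delta>)\<^sup>2)"
      unfolding quad by (simp add: power2_eq_square algebra_simps)
    finally show ?thesis using assms by simp
  qed
  have pos: "1 - s > 0" "s - \<delta> > 0" using \<open>s < 1\<close> \<open>\<delta> < s\<close> by auto
  have "1 / (1 - s) + 1 / (1 - \<delta> / s) - 1 = s * (1 - \<delta>) / ((1 - s) * (s - \<delta>))"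
    using pos \<open>0 < s\<close> by (simp add: divide_simps) (simp add: algebra_simps)
  also have "\<dots> = (1 + \<delta> + D) / (1 - \<delta>)"
    using pos assms id by (simp add: divide_simps) (simp add: power2_eq_square mult_ac)
  finally have G: "1 / (1 - s) + 1 / (1 - \<delta> / s) - 1 = (1 + \<delta> + D) / (1 - \<delta>)" .
  have "s powr (- k) \<le> \<E> k"
  proof (cases "k = 0")
    case False
    hence "k > 0" using assms by simp
    have "s powr (- k) \<le> (k / (k + 1)) powr (- k)"
      using \<open>k > 0\<close> ks by (intro powr_mono2') auto
    also have "\<dots> = \<E> k" using \<open>k > 0\<close> by (simp add: \<E>_def powr_minus powr_divide)
    finally show ?thesis .
  qed (use \<open>0 < s\<close> in \<open>simp add: \<E>_def\<close>)
  thus "geom_bound k \<delta> s \<le> \<U>\<^sub>r k \<delta>"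
    unfolding geom_bound_def \<U>\<^sub>r_def G D_def[symmetric]
    using \<open>D \<ge> 0\<close> assms by (intro mult_right_mono) auto
qed

text \<open>
  In the degenerate case \<open>k = \<delta> = 0\<close>, which occurs for \<open>K = n d\<close> and \<open>k\<^sup>+ = d + 1\<close>, the radius goes to
  infinity.
\<close>

lemma bound_at_optimum:
  assumes "k \<ge> 0" "0 \<le> \<delta>" "\<delta> < 1" "Y \<ge> 0"
    and bound: "\<And>s. \<delta> < s \<Longrightarrow> 0 < s \<Longrightarrow> s < 1 \<Longrightarrow> C \<le> Y * geom_bound k \<delta> s ^ n"
  shows "C \<le> Y * \<U>\<^sub>r k \<delta> ^ n"
proof (cases "k > 0 \<or> \<delta> > 0")
  case True
  then obtain s where s: "\<delta> < s" "0 < s" "s < 1" "geom_bound k \<delta> s \<le> \<U>\<^sub>r k \<delta>"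
    using geom_bound_optimum assms by blast
  have "s powr (- k) \<ge> 0" "1 / (1 - s) \<ge> 1" "1 / (1 - \<delta> / s) \<ge> 1" using s assms by auto
  hence "geom_bound k \<delta> s \<ge> 0" unfolding geom_bound_def by (intro mult_nonneg_nonneg) linarith+
  hence "Y * geom_bound k \<delta> s ^ n \<le> Y * \<U>\<^sub>r k \<delta> ^ n"
    using s assms by (intro mult_left_mono power_mono) auto
  with bound[OF s(1-3)] show ?thesis by linarith
next
  case False
  hence 0: "k = 0" "\<delta> = 0" using assms by auto
  have "((\<lambda>s. Y * (1 / (1 - s)) ^ n) \<longlongrightarrow> Y * (1 / (1 - 0)) ^ n) (at_right (0::real))"
    by (intro tendsto_intros) auto
  moreover have "\<forall>\<^sub>F s in at_right (0::real). C \<le> Y * (1 / (1 - s)) ^ n"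
    using eventually_at_right_less[of "0::real"] eventually_at_right_real[OF zero_less_one]
  proof eventually_elim
    case (elim s)
    thus ?case using bound[of s] by (simp add: 0 geom_bound_def)
  qed
  ultimately have "C \<le> Y * (1 / (1 - 0)) ^ n"
    by (intro tendsto_lowerbound) auto
  thus ?thesis by (simp add: 0 \<U>\<^sub>r_def \<E>_def)
qed
lemma sum_power_Suc_le:
  fixes x :: real
  assumes "0 \<le> x" "x < 1"
  shows "(\<Sum>j=1..m. x ^ j) \<le> 1 / (1 - x) - 1"
proof -
  have "1 + (\<Sum>j=1..m. x ^ j) = (\<Sum>j\<le>m. x ^ j)"
    by (simp add: atMost_atLeast0 sum.atLeast_Suc_atMost)
  also have "\<dots> \<le> (\<Sum>j. x ^ j)"
    using assms by (intro sum_le_suminf summable_geometric) auto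
  also have "\<dots> = 1 / (1 - x)" using assms by (simp add: suminf_geometric)
  finally show ?thesis by simp
qed

text \<open>
  A sum whose terms decay geometrically on both sides of a peak at \<open>q\<close>. The decay rates enter symmetrically,
  and this is why gaps above and below give the same function \<open>\<U>\<close>.
\<close>

lemma sum_two_sided_geometric_le:
  fixes f :: "nat \<Rightarrow> real"
  assumes x: "0 \<le> x" "x < 1" and y: "0 \<le> y" "y < 1" and "q \<le> d" "a \<ge> 0"
    and low: "\<And>j. j \<le> q \<Longrightarrow> f j \<le> a * x ^ (q - j)"
    and high: "\<And>j. q < j \<Longrightarrow> j \<le> d \<Longrightarrow> f j \<le> a * y ^ (j - q)"
  shows "(\<Sum>j\<le>d. f j) \<le> a * (1 / (1 - x) + 1 / (1 - y) - 1)"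
proof -
  have "(\<Sum>j\<le>d. f j) = (\<Sum>j\<le>q. f j) + (\<Sum>j\<in>{q<..d}. f j)"
    using \<open>q \<le> d\<close> by (subst sum.union_disjoint[symmetric]) (auto intro!: sum.cong)
  also have "(\<Sum>j\<le>q. f j) \<le> (\<Sum>j\<le>q. a * x ^ (q - j))"
    by (intro sum_mono low) auto
  also have "\<dots> = (\<Sum>j\<le>q. a * x ^ j)"
    by (rule sum.reindex_bij_witness[of _ "\<lambda>j. q - j" "\<lambda>j. q - j"]) auto
  also have "\<dots> = a * (1 + (\<Sum>j=1..q. x ^ j))"
    by (simp add: sum_distrib_left atMost_atLeast0 sum.atLeast_Suc_atMost distrib_left)
  also have "\<dots> \<le> a * (1 + (1 / (1 - x) - 1))"
    using \<open>a \<ge> 0\<close> x by (intro mult_left_mono add_left_mono sum_power_Suc_le) auto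
  also have "(\<Sum>j\<in>{q<..d}. f j) \<le> (\<Sum>j\<in>{q<..d}. a * y ^ (j - q))"
    by (intro sum_mono high) auto
  also have "\<dots> = (\<Sum>j=1..d-q. a * y ^ j)"
    by (rule sum.reindex_bij_witness[of _ "\<lambda>j. j + q" "\<lambda>j. j - q"]) auto
  also have "\<dots> = a * (\<Sum>j=1..d-q. y ^ j)"
    by (simp add: sum_distrib_left)
  also have "\<dots> \<le> a * (1 / (1 - y) - 1)"
    using \<open>a \<ge> 0\<close> y by (intro mult_left_mono sum_power_Suc_le) auto
  finally show ?thesis by (simp add: algebra_simps)
qed

text \<open>
  The radius is taken as \<open>t = 1 / s > 1\<close>: below \<open>q\<close> the growth of \<open>t ^ j\<close> is the geometric decay away from
  \<open>q\<close>, and above \<open>q\<close> the weights beat it because \<open>\<delta> t < 1\<close>.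
\<close>

lemma geom_bound_of_upper_ratio:
  fixes g :: "nat \<Rightarrow> real"
  assumes "n > 0" and "q \<le> d" and "0 \<le> \<delta>" "\<delta> < s" "0 < s" "s < 1" and "Y \<ge> 0"
    and g: "\<And>j. j \<le> d \<Longrightarrow> 0 \<le> g j" "\<And>j. j \<le> q \<Longrightarrow> g j \<le> 1"
      "\<And>j. q < j \<Longrightarrow> j \<le> d \<Longrightarrow> g j \<le> \<delta> ^ (j - q)"
    and bound: "\<And>t. t > 0 \<Longrightarrow> C * t ^ K \<le> Y * (\<Sum>j\<le>d. g j * t ^ j) ^ n"
  shows "C \<le> Y * geom_bound (real q - real K / real n) \<delta> s ^ n"
proof -
  let ?G = "1 / (1 - s) + 1 / (1 - \<delta> / s) - 1" and ?t = "1 / s"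
  have t: "?t > 0" "\<delta> * ?t = \<delta> / s" "s * ?t = 1" using assms by auto
  have pw: "?t ^ j = ?t ^ q * (?t ^ (j - q))" if "q \<le> j" for j
    using that by (simp add: power_add[symmetric] del: power_one_over)
  have pw': "?t ^ j = ?t ^ q * s ^ (q - j)" if "j \<le> q" for j
  proof -
    have "?t ^ q * s ^ (q - j) = ?t ^ j * (?t ^ (q - j) * s ^ (q - j))"
      using that by (simp add: power_add[symmetric] mult.assoc[symmetric] del: power_one_over)
    also have "?t ^ (q - j) * s ^ (q - j) = 1"
      using assms by (simp add: power_mult_distrib[symmetric] del: power_one_over)
    finally show ?thesis by simp
  qed
  have sum: "(\<Sum>j\<le>d. g j * ?t ^ j) \<le> ?t ^ q * ?G"
  proof (rule sum_two_sided_geometric_le)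
    fix j assume "j \<le> q"
    have "g j * ?t ^ j \<le> 1 * ?t ^ j" using t g \<open>j \<le> q\<close> by (intro mult_right_mono) auto
    thus "g j * ?t ^ j \<le> ?t ^ q * s ^ (q - j)" using pw'[OF \<open>j \<le> q\<close>] by simp
  next
    fix j assume j: "q < j" "j \<le> d"
    have "g j * ?t ^ j \<le> \<delta> ^ (j - q) * ?t ^ j" using t g j by (intro mult_right_mono) auto
    also have "\<dots> = ?t ^ q * (\<delta> / s) ^ (j - q)"
      using j by (subst pw) (simp_all add: power_divide)
    finally show "g j * ?t ^ j \<le> ?t ^ q * (\<delta> / s) ^ (j - q)" .
  qed (use assms in auto)
  have "C * ?t ^ K \<le> Y * (\<Sum>j\<le>d. g j * ?t ^ j) ^ n" by (rule bound) fact
  also have "\<dots> \<le> Y * (?t ^ q * ?G) ^ n"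
    using g \<open>Y \<ge> 0\<close> t by (intro mult_left_mono power_mono sum sum_nonneg) auto
  finally have le: "C * ?t ^ K \<le> Y * (?t ^ q * ?G) ^ n" .
  have "?t ^ q * ?G = s powr (- real q) * ?G"
    using assms by (simp add: powr_minus powr_realpow field_simps)
  also have "s powr (- real q) = s powr (- (real q - real K / real n)) * s powr (- (real K / real n))"
    by (simp add: powr_add[symmetric])
  finally have eq: "?t ^ q * ?G = s powr (- (real q - real K / real n)) * s powr (- (real K / real n)) * ?G" .
  have "(?t ^ q * ?G) ^ n
      = geom_bound (real q - real K / real n) \<delta> s ^ n * (s powr (- (real K / real n))) ^ n"
    unfolding eq geom_bound_def by (simp only: power_mult_distrib mult_ac)
  also have "(s powr (- (real K / real n))) ^ n = ?t ^ K"
    using assms by (simp add: powr_power powr_minus powr_realpow field_simps)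
  finally have "C * ?t ^ K \<le> (Y * geom_bound (real q - real K / real n) \<delta> s ^ n) * ?t ^ K"
    using le by (simp only: mult.assoc)
  thus ?thesis using t(1) by (simp only: mult_le_cancel_right_pos zero_less_power)
qed

text \<open>
  The mirror image of \<open>geom_bound_of_upper_ratio\<close>, with radius \<open>t = s < 1\<close>.
\<close>

lemma geom_bound_of_lower_ratio:
  fixes g :: "nat \<Rightarrow> real"
  assumes "n > 0" and "q \<le> d" and "0 \<le> \<delta>" "\<delta> < s" "0 < s" "s < 1" and "Y \<ge> 0"
    and g: "\<And>j. j \<le> d \<Longrightarrow> 0 \<le> g j" "\<And>j. q < j \<Longrightarrow> j \<le> d \<Longrightarrow> g j \<le> 1"
      "\<And>j. j \<le> q \<Longrightarrow> g j \<le> \<delta> ^ (q - j)"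
    and bound: "\<And>t. t > 0 \<Longrightarrow> C * t ^ K \<le> Y * (\<Sum>j\<le>d. g j * t ^ j) ^ n"
  shows "C \<le> Y * geom_bound (real K / real n - real q) \<delta> s ^ n"
proof -
  let ?G = "1 / (1 - \<delta> / s) + 1 / (1 - s) - 1"
  have pw: "s ^ j = s ^ q * (s ^ (j - q))" if "q \<le> j" for j
    using that by (simp add: power_add[symmetric])
  have sum: "(\<Sum>j\<le>d. g j * s ^ j) \<le> s ^ q * ?G"
  proof (rule sum_two_sided_geometric_le)
    fix j assume "j \<le> q"
    hence q: "s ^ q = s ^ j * s ^ (q - j)" by (simp add: power_add[symmetric])
    have "g j * s ^ j \<le> \<delta> ^ (q - j) * s ^ j" using assms \<open>j \<le> q\<close> by (intro mult_right_mono) auto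
    also have "\<dots> = s ^ q * (\<delta> / s) ^ (q - j)"
      using \<open>0 < s\<close> by (simp add: q power_divide)
    finally show "g j * s ^ j \<le> s ^ q * (\<delta> / s) ^ (q - j)" .
  next
    fix j assume j: "q < j" "j \<le> d"
    have "g j * s ^ j \<le> 1 * s ^ j" using assms j by (intro mult_right_mono) auto
    thus "g j * s ^ j \<le> s ^ q * s ^ (j - q)" using pw[of j] j by simp
  qed (use assms in auto)
  have "C * s ^ K \<le> Y * (\<Sum>j\<le>d. g j * s ^ j) ^ n" by (rule bound) fact
  also have "\<dots> \<le> Y * (s ^ q * ?G) ^ n"
    using assms by (intro mult_left_mono power_mono sum sum_nonneg) auto
  finally have le: "C * s ^ K \<le> Y * (s ^ q * ?G) ^ n" .
  have "s ^ q * ?G = s powr (real q) * ?G"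
    using assms by (simp add: powr_realpow)
  also have "s powr (real q) = s powr (- (real K / real n - real q)) * s powr (real K / real n)"
    by (simp add: powr_add[symmetric])
  finally have eq: "s ^ q * ?G = s powr (- (real K / real n - real q)) * s powr (real K / real n) * ?G" .
  have "(s ^ q * ?G) ^ n
      = geom_bound (real K / real n - real q) \<delta> s ^ n * (s powr (real K / real n)) ^ n"
    unfolding eq geom_bound_def by (simp only: power_mult_distrib mult_ac add.commute)
  also have "(s powr (real K / real n)) ^ n = s ^ K"
    using assms by (simp add: powr_power powr_realpow)
  finally have "C * s ^ K \<le> (Y * geom_bound (real K / real n - real q) \<delta> s ^ n) * s ^ K"
    using le by (simp only: mult.assoc)
  thus ?thesis using \<open>0 < s\<close> by (simp only: mult_le_cancel_right_pos zero_less_power)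
qed

section \<open>From circles to tropical gaps\<close>

lemma prod_block_index_pos:
  fixes \<alpha> :: "nat \<Rightarrow> real"
  assumes "n > 0" "K \<le> n * d" "\<And>i. i \<in> {1..d} \<Longrightarrow> \<alpha> i > 0"
  shows "(\<Prod>i=1..K. \<alpha> (block_index n i)) > 0"
proof (rule prod_pos)
  fix i assume "i \<in> {1..K}"
  hence "i \<in> {1..n * d}" using assms(2) by simp
  hence "block_index n i \<in> {1..d}" using block_index_bounds[OF assms(1)] by simp
  thus "\<alpha> (block_index n i) > 0" by (rule assms(3))
qed

text \<open>
  The estimate at radius \<open>\<alpha> m * root e t\<close>, after replacing each coefficient by its tropical bound. The
  powers of \<open>\<alpha> m\<close> combine with the product of the roots by \<open>prod_block_index_scaled\<close>, and those of \<open>a 0\<close> move to the left.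
\<close>

lemma tropical_scaling:
  fixes a \<alpha> :: "nat \<Rightarrow> real"
  assumes "n > 0" "e > 0" "K \<in> {1..n * d}"
    and \<alpha>: "\<And>i. i \<in> {1..d} \<Longrightarrow> \<alpha> i > 0"
    and a: "a 0 > 0" "\<And>j. j \<le> d \<Longrightarrow> 0 \<le> a j" "\<And>j. j \<le> d \<Longrightarrow> a j * (\<Prod>i=1..j. \<alpha> i) \<le> a 0"
    and "Z \<ge> 0"
    and bound: "\<And>r. r > 0 \<Longrightarrow> D ^ e * (r ^ K) ^ e \<le> (\<Sum>j\<le>d. (a j * r ^ j) ^ e) ^ n * Z ^ e"
    and "t > 0"
  defines "m \<equiv> block_index n K"
  defines "b \<equiv> ratio_prod \<alpha> m"
  shows "(D / a 0 ^ n) ^ e * t ^ K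
           \<le> (Z / (\<Prod>i=1..K. \<alpha> (block_index n i))) ^ e * (\<Sum>j\<le>d. (b j / b m) ^ e * t ^ j) ^ n"
proof -
  let ?\<beta> = "\<Prod>i=1..K. \<alpha> (block_index n i)" and ?S = "\<Sum>j\<le>d. (b j / b m) ^ e * t ^ j"
  have m: "m \<in> {1..d}" using block_index_bounds[OF assms(1,3)] by (simp add: m_def)
  have b_pos: "b j > 0" if "j \<le> d" for j
    unfolding b_def using \<alpha> m that by (rule ratio_prod_pos)
  have b_eq: "b j * (\<Prod>i=1..j. \<alpha> i) = \<alpha> m ^ j" if "j \<le> d" for j
  proof -
    have "b j * (\<Prod>i=1..j. \<alpha> i) = (\<Prod>i=1..j. \<alpha> m / \<alpha> i * \<alpha> i)"
      by (simp only: b_def ratio_prod_def prod.distrib)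
    also have "\<dots> = (\<Prod>i=1..j. \<alpha> m)"
    proof (rule prod.cong)
      fix i assume "i \<in> {1..j}"
      hence "\<alpha> i > 0" using that by (intro \<alpha>) auto
      thus "\<alpha> m / \<alpha> i * \<alpha> i = \<alpha> m" by simp
    qed simp
    finally show ?thesis by simp
  qed
  have \<beta>_pos: "?\<beta> > 0"
    using assms(3) \<alpha> by (intro prod_block_index_pos[OF assms(1)]) auto
  have \<beta>_eq: "?\<beta> * b m ^ n = \<alpha> m ^ K"
  proof -
    have "\<alpha> j \<noteq> 0" if "j \<in> {1..block_index n K}" for j
      using \<alpha>[of j] m that by (auto simp: m_def)
    thus ?thesis
      unfolding b_def ratio_prod_def m_def using assms(1,3) by (intro prod_block_index_scaled) auto
  qed
  \<comment> \<open>the radius in units of \<open>\<alpha> m\<close>, chosen so that \<open>\<rho>\<^sup>e\<close> runs through all \<open>t > 0\<close>\<close>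
  define \<rho> where "\<rho> = root e t"
  have \<rho>: "\<rho> > 0" "\<rho> ^ e = t" using assms by (auto simp: \<rho>_def)
  have "\<alpha> m > 0" using m by (rule \<alpha>)
  have summand_le: "(a j * (\<alpha> m * \<rho>) ^ j) ^ e \<le> (a 0 * b m) ^ e * ((b j / b m) ^ e * t ^ j)" if "j \<le> d" for j
  proof -
    have "a j * \<alpha> m ^ j = a j * (\<Prod>i=1..j. \<alpha> i) * b j"
      using b_eq[OF that] by (simp add: mult_ac)
    also have "\<dots> \<le> a 0 * b j"
      using a(3)[OF that] b_pos[OF that] by (intro mult_right_mono) auto
    finally have "a j * (\<alpha> m * \<rho>) ^ j \<le> a 0 * b j * \<rho> ^ j"
      using \<rho> by (simp add: power_mult_distrib mult.assoc[symmetric])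
    hence "(a j * (\<alpha> m * \<rho>) ^ j) ^ e \<le> (a 0 * b j * \<rho> ^ j) ^ e"
      using a(2)[OF that] \<rho> \<open>\<alpha> m > 0\<close> by (intro power_mono) auto
    also have "\<dots> = (a 0 * b m) ^ e * ((b j / b m) ^ e * (\<rho> ^ e) ^ j)"
      using b_pos[of m] m
      by (simp add: power_mult_distrib power_divide power_mult[symmetric] mult.commute[of e])
    finally show ?thesis by (simp only: \<rho>)
  qed
  have "(D ^ e * t ^ K) * (?\<beta> * b m ^ n) ^ e = D ^ e * ((\<alpha> m * \<rho>) ^ K) ^ e"
    unfolding \<beta>_eq \<rho>(2)[symmetric]
    by (simp add: power_mult_distrib power_mult[symmetric] mult.commute[of e])
  also have "\<dots> \<le> (\<Sum>j\<le>d. (a j * (\<alpha> m * \<rho>) ^ j) ^ e) ^ n * Z ^ e"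
    using \<rho> \<open>\<alpha> m > 0\<close> by (intro bound) simp
  also have "\<dots> \<le> (\<Sum>j\<le>d. (a 0 * b m) ^ e * ((b j / b m) ^ e * t ^ j)) ^ n * Z ^ e"
    using a(2) \<rho> \<open>\<alpha> m > 0\<close> \<open>Z \<ge> 0\<close>
    by (intro mult_right_mono power_mono sum_mono summand_le sum_nonneg) auto
  also have "\<dots> = ((a 0 * b m) ^ e * ?S) ^ n * Z ^ e"
    by (simp add: sum_distrib_left)
  also have "\<dots> = Z ^ e * ?S ^ n * ((a 0 ^ n * b m ^ n) ^ e)"
    by (simp add: power_mult_distrib power_mult[symmetric] mult_ac)
  finally have "(D ^ e * t ^ K) * (?\<beta> * b m ^ n) ^ e \<le> Z ^ e * ?S ^ n * ((a 0 ^ n * b m ^ n) ^ e)" .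
  hence "(D ^ e * t ^ K * ?\<beta> ^ e) * (b m ^ n) ^ e \<le> (Z ^ e * ?S ^ n * (a 0 ^ n) ^ e) * (b m ^ n) ^ e"
    by (simp only: power_mult_distrib mult_ac)
  hence "D ^ e * t ^ K * ?\<beta> ^ e \<le> Z ^ e * ?S ^ n * (a 0 ^ n) ^ e"
    using b_pos[of m] m by simp
  thus ?thesis
    using \<beta>_pos a(1) by (simp add: power_divide field_simps)
qed

text \<open>
  The gap between the roots of index \<open>m = \<lceil>K/n\<rceil>\<close> and \<open>kp\<close> makes the weights decay from \<open>q = kp - 1\<close> on.
  For \<open>kp = d + 1\<close> no coefficients lie beyond \<open>q\<close>, in line with the convention \<open>\<alpha>\<^bsub>d+1\<^esub> = \<infinity>\<close>.
\<close>

lemma lower_bound_upper_gap: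
  fixes a \<alpha> :: "nat \<Rightarrow> real"
  assumes "n > 0" "e > 0" "K \<in> {1..n * d}"
    and \<alpha>: "\<And>i. i \<in> {1..d} \<Longrightarrow> \<alpha> i > 0" "mono_on {1..d} \<alpha>"
    and a: "a 0 > 0" "\<And>j. j \<le> d \<Longrightarrow> 0 \<le> a j" "\<And>j. j \<le> d \<Longrightarrow> a j * (\<Prod>i=1..j. \<alpha> i) \<le> a 0"
    and "Z \<ge> 0"
    and bound: "\<And>r. r > 0 \<Longrightarrow> D ^ e * (r ^ K) ^ e \<le> (\<Sum>j\<le>d. (a j * r ^ j) ^ e) ^ n * Z ^ e"
    and kp: "block_index n K < kp" "kp \<le> d + 1"
    and \<delta>: "0 \<le> \<delta>" "\<delta> < 1" "kp \<le> d \<Longrightarrow> \<alpha> (block_index n K) / \<alpha> kp \<le> \<delta>"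
  shows "(D / a 0 ^ n) ^ e
           \<le> (Z / (\<Prod>i=1..K. \<alpha> (block_index n i))) ^ e * \<U>\<^sub>r (real kp - real K / real n - 1) (\<delta> ^ e) ^ n"
proof -
  define m where "m = block_index n K"
  define b where "b = ratio_prod \<alpha> m"
  define q where "q = kp - 1"
  have q: "m \<le> q" "q \<le> d" "kp = Suc q" using kp by (auto simp: q_def m_def)
  have m: "m \<in> {1..d}" using block_index_bounds[OF assms(1,3)] by (simp add: m_def)
  have b_pos: "b j > 0" if "j \<le> d" for j
    unfolding b_def using \<alpha>(1) m that by (rule ratio_prod_pos)
  have b_le: "b j \<le> b m" if "j \<le> d" for j
    unfolding b_def using \<alpha> m that by (rule ratio_prod_le)
  have b_decay: "b j \<le> \<delta> ^ (j - q) * b m" if "q < j" "j \<le> d" for j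
  proof -
    have "b j \<le> \<delta> ^ (j - q) * b q"
      unfolding b_def using \<delta> q that by (intro ratio_prod_decay[OF \<alpha> m]) (auto simp: m_def)
    also have "\<dots> \<le> \<delta> ^ (j - q) * b m" using \<delta> q by (intro mult_left_mono b_le) auto
    finally show ?thesis .
  qed
  have "b m > 0" using m by (intro b_pos) auto
  have Z: "0 \<le> (Z / (\<Prod>i=1..K. \<alpha> (block_index n i))) ^ e"
    using \<open>Z \<ge> 0\<close> prod_block_index_pos[of n K d \<alpha>] assms(1,3) \<alpha>(1) by simp
  have "(D / a 0 ^ n) ^ e
      \<le> (Z / (\<Prod>i=1..K. \<alpha> (block_index n i))) ^ e * \<U>\<^sub>r (real q - real K / real n) (\<delta> ^ e) ^ n"
  proof (rule bound_at_optimum)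
    show "0 \<le> real q - real K / real n"
      using block_index_real_bounds(2)[OF assms(1), of K] assms(3) q by (simp add: m_def)
    show "\<delta> ^ e < 1" using \<delta> \<open>e > 0\<close> by (simp add: power_less_one_iff)
    fix s assume s: "\<delta> ^ e < s" "0 < s" "s < 1"
    show "(D / a 0 ^ n) ^ e \<le> (Z / (\<Prod>i=1..K. \<alpha> (block_index n i))) ^ e
        * geom_bound (real q - real K / real n) (\<delta> ^ e) s ^ n"
    proof (rule geom_bound_of_upper_ratio[where g = "\<lambda>j. (b j / b m) ^ e" and d = d])
      fix j assume "j \<le> d"
      thus "0 \<le> (b j / b m) ^ e" using b_pos[of j] \<open>b m > 0\<close> by simp
    next
      fix j assume "j \<le> q"
      hence "b j \<le> b m" "b j > 0" using q by (auto intro: b_le b_pos)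
      thus "(b j / b m) ^ e \<le> 1" using \<open>b m > 0\<close> by (intro power_le_one) auto
    next
      fix j assume j: "q < j" "j \<le> d"
      have "b j / b m \<le> \<delta> ^ (j - q)" using b_decay[OF j] \<open>b m > 0\<close> by (simp add: field_simps)
      hence "(b j / b m) ^ e \<le> (\<delta> ^ (j - q)) ^ e"
        using \<open>b m > 0\<close> b_pos[OF j(2)] by (intro power_mono) auto
      thus "(b j / b m) ^ e \<le> (\<delta> ^ e) ^ (j - q)"
        by (simp add: power_mult[symmetric] mult.commute)
    next
      fix t :: real assume "t > 0"
      show "(D / a 0 ^ n) ^ e * t ^ K \<le> (Z / (\<Prod>i=1..K. \<alpha> (block_index n i))) ^ e
          * (\<Sum>j\<le>d. (b j / b m) ^ e * t ^ j) ^ n"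
        unfolding b_def m_def
        using assms(1-3) \<alpha>(1) a \<open>Z \<ge> 0\<close> bound \<open>t > 0\<close> by (rule tropical_scaling)
    qed (use assms q s Z in auto)
  qed (use \<delta> Z in auto)
  thus ?thesis using q by (simp add: algebra_simps)
qed

text \<open>
  Here the gap between the roots of index \<open>km\<close> and \<open>m = \<lceil>K/n\<rceil>\<close> makes the weights decay from \<open>km\<close>
  downwards. For \<open>km = 0\<close> there is nothing below \<open>km\<close>, in line with the convention \<open>\<alpha>\<^sub>0 = 0\<close>.
\<close>

lemma lower_bound_lower_gap:
  fixes a \<alpha> :: "nat \<Rightarrow> real"
  assumes "n > 0" "e > 0" "K \<in> {1..n * d}"
    and \<alpha>: "\<And>i. i \<in> {1..d} \<Longrightarrow> \<alpha> i > 0" "mono_on {1..d} \<alpha>"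
    and a: "a 0 > 0" "\<And>j. j \<le> d \<Longrightarrow> 0 \<le> a j" "\<And>j. j \<le> d \<Longrightarrow> a j * (\<Prod>i=1..j. \<alpha> i) \<le> a 0"
    and "Z \<ge> 0"
    and bound: "\<And>r. r > 0 \<Longrightarrow> D ^ e * (r ^ K) ^ e \<le> (\<Sum>j\<le>d. (a j * r ^ j) ^ e) ^ n * Z ^ e"
    and km: "km < block_index n K"
    and \<delta>: "0 \<le> \<delta>" "\<delta> < 1" "km > 0 \<Longrightarrow> \<alpha> km / \<alpha> (block_index n K) \<le> \<delta>"
  shows "(D / a 0 ^ n) ^ e
           \<le> (Z / (\<Prod>i=1..K. \<alpha> (block_index n i))) ^ e * \<U>\<^sub>r (real K / real n - real km) (\<delta> ^ e) ^ n"
proof -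
  define m where "m = block_index n K"
  define b where "b = ratio_prod \<alpha> m"
  have m: "m \<in> {1..d}" using block_index_bounds[OF assms(1,3)] by (simp add: m_def)
  have km': "km < m" "km \<le> d" using km m by (auto simp: m_def)
  have b_pos: "b j > 0" if "j \<le> d" for j
    unfolding b_def using \<alpha>(1) m that by (rule ratio_prod_pos)
  have b_le: "b j \<le> b m" if "j \<le> d" for j
    unfolding b_def using \<alpha> m that by (rule ratio_prod_le)
  have b_growth: "b j \<le> \<delta> ^ (km - j) * b m" if "j \<le> km" for j
  proof -
    have "b j \<le> \<delta> ^ (km - j) * b km"
      unfolding b_def using \<delta> km' that by (intro ratio_prod_growth[OF \<alpha> m]) (auto simp: m_def)
    also have "\<dots> \<le> \<delta> ^ (km - j) * b m" using \<delta> km' by (intro mult_left_mono b_le) auto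
    finally show ?thesis .
  qed
  have "b m > 0" using m by (intro b_pos) auto
  have Z: "0 \<le> (Z / (\<Prod>i=1..K. \<alpha> (block_index n i))) ^ e"
    using \<open>Z \<ge> 0\<close> prod_block_index_pos[of n K d \<alpha>] assms(1,3) \<alpha>(1) by simp
  show ?thesis
  proof (rule bound_at_optimum)
    show "0 \<le> real K / real n - real km"
      using block_index_real_bounds(1)[OF assms(1), of K] assms(3) km by (simp add: m_def)
    show "\<delta> ^ e < 1" using \<delta> \<open>e > 0\<close> by (simp add: power_less_one_iff)
    fix s assume s: "\<delta> ^ e < s" "0 < s" "s < 1"
    show "(D / a 0 ^ n) ^ e \<le> (Z / (\<Prod>i=1..K. \<alpha> (block_index n i))) ^ e
        * geom_bound (real K / real n - real km) (\<delta> ^ e) s ^ n"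
    proof (rule geom_bound_of_lower_ratio[where g = "\<lambda>j. (b j / b m) ^ e" and d = d])
      fix j assume "j \<le> d"
      thus "0 \<le> (b j / b m) ^ e" using b_pos[of j] \<open>b m > 0\<close> by simp
    next
      fix j assume "km < j" "j \<le> d"
      hence "b j \<le> b m" "b j > 0" by (auto intro: b_le b_pos)
      thus "(b j / b m) ^ e \<le> 1" using \<open>b m > 0\<close> by (intro power_le_one) auto
    next
      fix j assume j: "j \<le> km"
      have "b j / b m \<le> \<delta> ^ (km - j)" using b_growth[OF j] \<open>b m > 0\<close> by (simp add: field_simps)
      hence "(b j / b m) ^ e \<le> (\<delta> ^ (km - j)) ^ e"
        using \<open>b m > 0\<close> b_pos[of j] km' j by (intro power_mono) auto
      thus "(b j / b m) ^ e \<le> (\<delta> ^ e) ^ (km - j)"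
        by (simp add: power_mult[symmetric] mult.commute)
    next
      fix t :: real assume "t > 0"
      show "(D / a 0 ^ n) ^ e * t ^ K \<le> (Z / (\<Prod>i=1..K. \<alpha> (block_index n i))) ^ e
          * (\<Sum>j\<le>d. (b j / b m) ^ e * t ^ j) ^ n"
        unfolding b_def m_def
        using assms(1-3) \<alpha>(1) a \<open>Z \<ge> 0\<close> bound \<open>t > 0\<close> by (rule tropical_scaling)
    qed (use assms km' s Z in auto)
  qed (use \<delta> Z in auto)
qed

section \<open>Lower bounds for products of eigenvalues\<close>

text \<open>
  The real value of \<open>1 / \<U> k \<delta>\<close>, with 0 at \<open>\<delta> = 1\<close> where \<open>\<U>\<close> is infinite.
\<close>

definition \<U>_inv :: "real \<Rightarrow> real \<Rightarrow> real" where
  "\<U>_inv k \<delta> = (if \<delta> = 1 then 0 else 1 / \<U>\<^sub>r k \<delta>)"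

lemma inverse_\<U>:
  assumes "k \<ge> 0" "0 \<le> \<delta>" "\<delta> \<le> 1"
  shows "1 / \<U> k \<delta> = ereal (\<U>_inv k \<delta>)"
  using assms \<U>\<^sub>r_ge_1[of k \<delta>]
  by (cases "\<delta> = 1") (auto simp: \<U>_1 \<U>_eq_\<U>\<^sub>r \<U>_inv_def one_ereal_def)

lemma inverse_sqrt_\<U>:
  assumes "k \<ge> 0" "0 \<le> \<delta>" "\<delta> \<le> 1"
  shows "1 / ereal_sqrt (\<U> k \<delta>) = ereal (sqrt (\<U>_inv k \<delta>))"
  using assms \<U>\<^sub>r_ge_1[of k \<delta>]
  by (cases "\<delta> = 1") (auto simp: \<U>_1 \<U>_eq_\<U>\<^sub>r \<U>_inv_def one_ereal_def ereal_sqrt_def real_sqrt_divide)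

lemma \<U>_inv_le_sqrt:
  assumes "k \<ge> 0" "0 \<le> \<delta>" "\<delta> \<le> 1"
  shows "\<U>_inv k \<delta> \<le> sqrt (\<U>_inv k (\<delta>\<^sup>2))"
proof (cases "\<delta> = 1")
  case False
  hence lt: "\<delta> < 1" using assms by simp
  hence lt2: "\<delta>\<^sup>2 < 1" using assms by (simp add: abs_square_less_1)
  have "1 / (\<U>\<^sub>r k \<delta>)\<^sup>2 \<le> 1 / \<U>\<^sub>r k (\<delta>\<^sup>2)"
    using \<U>\<^sub>r_square_le[OF assms(1,2) lt] \<U>\<^sub>r_ge_1[OF assms(1) zero_le_power2 lt2]
    by (intro frac_le) auto
  thus ?thesis using lt lt2 by (intro real_le_rsqrt) (simp add: \<U>_inv_def power_divide)
qed (simp add: \<U>_inv_def)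

lemma mult_inverse_power_le:
  fixes c X u :: real
  assumes "e > 0" "X \<ge> 0" "u > 0" "c ^ e \<le> X ^ e * u ^ n"
  shows "c * root e (1 / u) ^ n \<le> X"
proof (rule power_le_imp_le_base)
  have "(c * root e (1 / u) ^ n) ^ Suc (e - 1) = c ^ e * (root e (1 / u) ^ e) ^ n"
    using \<open>e > 0\<close> by (simp add: power_mult_distrib power_mult[symmetric] mult.commute del: power_Suc)
  also have "\<dots> = c ^ e / u ^ n"
    using assms by (simp add: power_divide)
  also have "\<dots> \<le> X ^ e" using assms by (simp add: field_simps)
  finally show "(c * root e (1 / u) ^ n) ^ Suc (e - 1) \<le> X ^ Suc (e - 1)"
    using \<open>e > 0\<close> by simp
qed fact

lemma mult_\<U>_inv_power_le:
  assumes "e > 0" "X \<ge> 0" "n > 0" "k \<ge> 0" "0 \<le> \<delta>" "\<delta> \<le> 1"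
    and "\<delta> < 1 \<Longrightarrow> c ^ e \<le> X ^ e * \<U>\<^sub>r k (\<delta> ^ e) ^ n"
  shows "c * root e (\<U>_inv k (\<delta> ^ e)) ^ n \<le> X"
proof (cases "\<delta> = 1")
  case True
  thus ?thesis using assms by (simp add: \<U>_inv_def zero_power)
next
  case False
  hence "\<delta> < 1" using assms by simp
  hence "\<delta> ^ e < 1" using assms by (simp add: power_less_one_iff)
  moreover have "c * root e (1 / \<U>\<^sub>r k (\<delta> ^ e)) ^ n \<le> X"
    using assms \<open>\<delta> < 1\<close> \<U>\<^sub>r_ge_1[of k "\<delta> ^ e"] \<open>\<delta> ^ e < 1\<close>
    by (intro mult_inverse_power_le) auto
  ultimately show ?thesis by (simp add: \<U>_inv_def)
qed

lemma infinite_eigenvalue_product: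
  fixes P :: "(complex^'n^'n) poly"
  assumes "eigenvalues_ordered P \<zeta>" "K \<le> CARD('n) * degree P" "det (coeff P 0) \<noteq> 0"
    and "i \<in> {1..K}" "\<zeta> i = None"
  shows "(\<Prod>i=1..K. modulus (\<zeta> i)) = \<infinity>"
proof -
  have pos: "modulus (\<zeta> j) > 0" if "j \<in> {1..K}" for j
  proof (cases "\<zeta> j")
    case (Some z)
    have "\<zeta> j \<noteq> Some 0" using assms(1-3) that by (intro eigenvalue_not_0) auto
    thus ?thesis using Some by (simp add: modulus_def)
  qed (simp add: modulus_def)
  have "(\<Prod>j\<in>{1..K} - {i}. modulus (\<zeta> j)) \<ge> 0"
    using pos by (intro prod_ereal_pos) (simp add: less_imp_le)
  moreover have "(\<Prod>j\<in>{1..K} - {i}. modulus (\<zeta> j)) \<noteq> 0"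
    using pos by (force simp: prod_ereal_0)
  ultimately have "(\<Prod>j\<in>{1..K} - {i}. modulus (\<zeta> j)) > 0" by order
  moreover have "(\<Prod>i=1..K. modulus (\<zeta> i)) = modulus (\<zeta> i) * (\<Prod>j\<in>{1..K} - {i}. modulus (\<zeta> j))"
    using assms(4) by (intro prod.remove) auto
  ultimately show ?thesis using assms(5) by (simp add: modulus_def)
qed

theorem theorem4p5:
  fixes P :: "(complex^'n^'n) poly"
    and N :: "complex^'n^'n \<Rightarrow> real"
    and \<zeta> :: "nat \<Rightarrow> complex option"
    and \<alpha> :: "nat \<Rightarrow> real"
    and n d K km kp :: nat
    and c \<delta>m \<delta>p :: real
  assumes "n = CARD('n)" and "d = degree P" and "d \<ge> 1"
    and "eigenvalues_ordered P \<zeta>"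
    and "matrix_norm N" and "cond_A1 N"
    and "det (coeff P 0) \<noteq> 0"
    and "c = cmod (det (coeff P 0)) / N (coeff P 0) ^ n"
    and "tropical_roots N P \<alpha>"
    and "K \<in> {1..n * d}"
    and "km < block_index n K" and "block_index n K < kp" and "kp \<le> d + 1"
    and "\<delta>m = real_of_ereal (ext_root d \<alpha> km / ext_root d \<alpha> (block_index n K))"
    and "\<delta>p = real_of_ereal (ext_root d \<alpha> (block_index n K) / ext_root d \<alpha> kp)"
  shows "(\<Prod>i=1..K. modulus (\<zeta> i)) / (\<Prod>i=1..K. ext_root d \<alpha> (block_index n i))
           \<ge> ereal c * L km kp \<delta>m \<delta>p (real K / real n) ^ n
       \<and> (cond_A2 N \<longrightarrow>
            L km kp \<delta>m \<delta>p (real K / real n) \<le> L_star km kp \<delta>m \<delta>p (real K / real n) \<and>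
            (\<Prod>i=1..K. modulus (\<zeta> i)) / (\<Prod>i=1..K. ext_root d \<alpha> (block_index n i))
              \<ge> ereal c * L_star km kp \<delta>m \<delta>p (real K / real n) ^ n)"
proof -
  let ?R = "(\<Prod>i=1..K. modulus (\<zeta> i)) / (\<Prod>i=1..K. ext_root d \<alpha> (block_index n i))"
  define m where "m = block_index n K"
  define \<beta> where "\<beta> = (\<Prod>i=1..K. \<alpha> (block_index n i))"
  define \<kappa>p where "\<kappa>p = real kp - real K / real n - 1"
  define \<kappa>m where "\<kappa>m = real K / real n - real km"
  have n: "n > 0" using assms(1) by simp
  have K: "K \<in> {1..n * d}" "K \<le> CARD('n) * degree P" using assms by auto
  have m: "m \<in> {1..d}" using block_index_bounds[OF n K(1)] by (simp add: m_def)
  have A0: "coeff P 0 \<noteq> 0" using assms(7) by (auto simp: det_zero_matrix)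
  have N_nonneg: "N A \<ge> 0" for A using assms(5) by (simp add: matrix_norm_def)
  have N0: "N (coeff P 0) > 0"
    using assms(5) A0 N_nonneg[of "coeff P 0"] unfolding matrix_norm_def by (metis order_le_less)
  have \<alpha>: "\<alpha> i > 0" if "i \<in> {1..d}" for i
    using tropical_roots_pos[OF assms(5,9) A0] that assms(2) by simp
  have mono: "mono_on {1..d} \<alpha>" using assms(2,9) by (simp add: tropical_roots_def)
  have coeff_le: "N (coeff P j) * (\<Prod>i=1..j. \<alpha> i) \<le> N (coeff P 0)" if "j \<le> d" for j
    using norm_coeff_le_tropical[OF assms(5,9) A0] that assms(2) by simp
  have block: "block_index n i \<in> {1..d}" if "i \<in> {1..K}" for i
    using block_index_bounds[OF n, of i d] that K by auto
  have ext: "ext_root d \<alpha> i = ereal (\<alpha> i)" if "i \<in> {1..d}" for i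
    using that by (auto simp: ext_root_def)
  have \<beta>: "\<beta> > 0" unfolding \<beta>_def using K(1) \<alpha> by (intro prod_block_index_pos[OF n]) auto
  have ext_prod: "(\<Prod>i=1..K. ext_root d \<alpha> (block_index n i)) = ereal \<beta>"
    unfolding \<beta>_def prod_ereal[symmetric] by (intro prod.cong refl ext block)

  have \<kappa>: "\<kappa>p \<ge> 0" "\<kappa>m \<ge> 0"
    using block_index_real_bounds[OF n, of K] K assms(11,12) by (auto simp: \<kappa>p_def \<kappa>m_def)
  have mono': "\<alpha> i \<le> \<alpha> j" if "1 \<le> i" "i \<le> j" "j \<le> d" for i j
    using mono that by (auto simp: mono_on_def)
  have \<delta>m_eq: "\<delta>m = (if km = 0 then 0 else \<alpha> km / \<alpha> m)"
  proof (cases "km = 0")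
    case False
    hence "km \<in> {1..d}" using assms(11) m by (auto simp: m_def)
    thus ?thesis using False \<alpha>[OF m] assms(14) ext[of km] ext[OF m] by (simp add: m_def)
  qed (use assms(14) in \<open>simp add: ext_root_def\<close>)
  have \<delta>p_eq: "\<delta>p = (if kp = d + 1 then 0 else \<alpha> m / \<alpha> kp)"
  proof (cases "kp = d + 1")
    case True
    thus ?thesis using assms(15) ext[OF m] by (simp add: m_def ext_root_def)
  next
    case False
    hence "kp \<in> {1..d}" using assms(12,13) m by (auto simp: m_def)
    thus ?thesis using False \<alpha>[of kp] assms(15) ext[of kp] ext[OF m] by (simp add: m_def)
  qed
  have \<delta>m: "0 \<le> \<delta>m" "\<delta>m \<le> 1" "km > 0 \<Longrightarrow> \<alpha> km / \<alpha> (block_index n K) \<le> \<delta>m"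
  proof -
    show "0 \<le> \<delta>m" "\<delta>m \<le> 1"
      using m assms(11) \<alpha>[of km] \<alpha>[of m] mono'[of km m] by (auto simp: \<delta>m_eq m_def)
  qed (simp add: \<delta>m_eq m_def)
  have \<delta>p: "0 \<le> \<delta>p" "\<delta>p \<le> 1" "kp \<le> d \<Longrightarrow> \<alpha> (block_index n K) / \<alpha> kp \<le> \<delta>p"
  proof -
    show "0 \<le> \<delta>p" "\<delta>p \<le> 1"
      using m assms(12,13) \<alpha>[of kp] \<alpha>[of m] mono'[of m kp] by (auto simp: \<delta>p_eq m_def)
  qed (simp add: \<delta>p_eq m_def)
  have sq: "0 \<le> \<delta>\<^sup>2 \<and> \<delta>\<^sup>2 \<le> 1" if "0 \<le> \<delta>" "\<delta> \<le> 1" for \<delta> :: real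
    using that by (simp add: power_le_one)

  have L_eq: "L km kp \<delta>m \<delta>p (real K / real n) = ereal (max (\<U>_inv \<kappa>p \<delta>p) (\<U>_inv \<kappa>m \<delta>m))"
    using inverse_\<U>[OF \<kappa>(1) \<delta>p(1,2)] inverse_\<U>[OF \<kappa>(2) \<delta>m(1,2)]
    by (simp add: L_def L_plus_def L_minus_def \<kappa>p_def \<kappa>m_def)
  have L_star_eq: "L_star km kp \<delta>m \<delta>p (real K / real n)
      = ereal (max (sqrt (\<U>_inv \<kappa>p (\<delta>p\<^sup>2))) (sqrt (\<U>_inv \<kappa>m (\<delta>m\<^sup>2))))"
    using inverse_sqrt_\<U>[OF \<kappa>(1), of "\<delta>p\<^sup>2"] inverse_sqrt_\<U>[OF \<kappa>(2), of "\<delta>m\<^sup>2"]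
      sq[OF \<delta>p(1,2)] sq[OF \<delta>m(1,2)]
    by (simp add: L_star_def L_plus_star_def L_minus_star_def \<kappa>p_def \<kappa>m_def)
  have L_le: "L km kp \<delta>m \<delta>p (real K / real n) \<le> L_star km kp \<delta>m \<delta>p (real K / real n)"
    unfolding L_eq L_star_eq ereal_less_eq
    by (intro max.mono \<U>_inv_le_sqrt \<kappa> \<delta>m \<delta>p)

  \<comment> \<open>the bound by \<open>L\<close> is the case \<open>e = 1\<close>, the one by \<open>L_star\<close> the case \<open>e = 2\<close>\<close>
  have main: "ereal (c * max (root e (\<U>_inv \<kappa>p (\<delta>p ^ e))) (root e (\<U>_inv \<kappa>m (\<delta>m ^ e))) ^ n) \<le> ?R"
    if e: "e = 1 \<and> cond_A1 N \<or> e = 2 \<and> cond_A2 N" for e :: nat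
  \<comment> \<open>an infinite eigenvalue makes the product infinite because no eigenvalue vanishes\<close>
  proof (cases "\<exists>i\<in>{1..K}. \<zeta> i = None")
    case True
    hence "(\<Prod>i=1..K. modulus (\<zeta> i)) = \<infinity>"
      using infinite_eigenvalue_product[OF assms(4) K(2) assms(7)] by blast
    thus ?thesis using \<beta> unfolding ext_prod by simp
  next
    case False
    have fin: "\<zeta> i \<noteq> None" if "i \<in> {1..K}" for i using False that by metis
    define Z where "Z = (\<Prod>i=1..K. cmod (the (\<zeta> i)))"
    have "(\<Prod>i=1..K. modulus (\<zeta> i)) = ereal Z"
      unfolding Z_def prod_ereal[symmetric]
      using fin by (intro prod.cong) (auto simp: modulus_def split: option.split)
    hence R: "?R = ereal (Z / \<beta>)" using \<beta> unfolding ext_prod by simp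
    have "Z \<ge> 0" by (simp add: Z_def prod_nonneg)
    have "e > 0" using e by auto
    have bound: "cmod (det (coeff P 0)) ^ e * (r ^ K) ^ e
        \<le> (\<Sum>j\<le>d. (N (coeff P j) * r ^ j) ^ e) ^ n * Z ^ e" if "r > 0" for r
      using eigenvalue_product_bound[OF assms(4) K(2) assms(7) fin assms(5) e that]
      by (simp add: assms(1,2) Z_def)
    have plus: "c ^ e \<le> (Z / \<beta>) ^ e * \<U>\<^sub>r \<kappa>p (\<delta>p ^ e) ^ n" if "\<delta>p < 1"
      unfolding assms(8) \<beta>_def \<kappa>p_def
      by (rule lower_bound_upper_gap[where a = "\<lambda>j. N (coeff P j)" and d = d])
         (use n \<open>e > 0\<close> K(1) \<alpha> mono N0 N_nonneg coeff_le \<open>Z \<ge> 0\<close> bound assms(12,13) \<delta>p that in auto)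
    have minus: "c ^ e \<le> (Z / \<beta>) ^ e * \<U>\<^sub>r \<kappa>m (\<delta>m ^ e) ^ n" if "\<delta>m < 1"
      unfolding assms(8) \<beta>_def \<kappa>m_def
      by (rule lower_bound_lower_gap[where a = "\<lambda>j. N (coeff P j)" and d = d])
         (use n \<open>e > 0\<close> K(1) \<alpha> mono N0 N_nonneg coeff_le \<open>Z \<ge> 0\<close> bound assms(11) \<delta>m that in auto)
    have "Z / \<beta> \<ge> 0" using \<beta> \<open>Z \<ge> 0\<close> by simp
    have "c * root e (\<U>_inv \<kappa>p (\<delta>p ^ e)) ^ n \<le> Z / \<beta>"
      using \<open>e > 0\<close> \<open>Z / \<beta> \<ge> 0\<close> n \<kappa>(1) \<delta>p(1,2) plus by (rule mult_\<U>_inv_power_le)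
    moreover have "c * root e (\<U>_inv \<kappa>m (\<delta>m ^ e)) ^ n \<le> Z / \<beta>"
      using \<open>e > 0\<close> \<open>Z / \<beta> \<ge> 0\<close> n \<kappa>(2) \<delta>m(1,2) minus by (rule mult_\<U>_inv_power_le)
    ultimately show ?thesis unfolding R by (simp add: max_def)
  qed
  have push: "ereal c * ereal M ^ n = ereal (c * M ^ n)" for M by simp
  have "ereal c * L km kp \<delta>m \<delta>p (real K / real n) ^ n \<le> ?R"
    using main[of 1] assms(6) unfolding L_eq push by simp
  moreover have "ereal c * L_star km kp \<delta>m \<delta>p (real K / real n) ^ n \<le> ?R" if "cond_A2 N"
    using main[of 2] that unfolding L_star_eq push by (simp add: sqrt_def)
  ultimately show ?thesis using L_le by blast
qed

end
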